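(* Let $A$ be a finite alphabet. The algebra isomorphism $\mathrm{QSym}_A\to(\mathrm{NSym}_A)^{gr}$, $M_I\mapsto H_I^*$, is a Hopf algebra isomorphism, where $\mathrm{QSym}_A$ carries the coproduct $\delta$ defined by doubling the variables. In particular, the deconcatenation coproduct in $(\mathrm{NSym}_A)^{gr}$ can be realized by the variables doubling method in $\mathrm{QSym}_A$: for every sentence $I$, $$\delta(M_I)=\sum_{I=J\cdot K}M_J\otimes M_K,$$ i.e. $$\delta(M_{(w_1,w_2,\dots,w_k)})=\sum_{j=0}^{k}M_{(w_1,\dots,w_j)}\otimes M_{(w_{j+1},\dots,w_k)} .$$
   Context: $\Bbbk$ is a field of characteristic zero. A sentence $I=(w_1,\dots,w_m)$ over $A$ is a finite sequence of non-empty words in letters of $A$; $1$ is the empty sentence; $|I|$ is the total number of letters; $I\cdot J$ is concatenation of sequences of words. $\mathrm{NSym}_A$ is the Hopf algebra over $\Bbbk$ with linear basis $(H_I)$ indexed by sentences, graded by $|I|$, with product $H_I\cdot H_J=H_{I\cdot J}$ and coproduct $\Delta(H_I)=\sum_{J\subset I}H_{\widetilde{I\setminus J}}\otimes H_{\widetilde J}$. Here, for $I=(w_1,\dots,w_m)$, $J=(v_1,\dots,v_m)$ runs over sequences of possibly empty words such that $w_i=u_iv_i$ for some words $u_i$; $I\setminus J=(u_1,\dots,u_m)$; and tilde means deleting the empty words. Its graded dual Hopf algebra $(\mathrm{NSym}_A)^{gr}$ has the basis $(H_I^* )$ dual to $(H_I)$; its coproduct (deconcatenation), dual to the product, is $\delta(H_I^*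 )=\sum_{I=J\cdot K}H_J^*\otimes H_K^*$. Partially commutative variables: $x_A=\{x_{a,i}: a\in A,\ i=1,2,\dots\}$, each of degree $1$, subject only to $x_{a,i}x_{b,j}=x_{b,j}x_{a,i}$ for $i\neq j$, $a,b\in A$. $\Bbbk[x_A]$ is the algebra of formal series of bounded degree in these variables. For a word $w=a_{i_1}\cdots a_{i_k}$ put $x_{w,j}=x_{a_{i_1},j}\cdots x_{a_{i_k},j}$; for a sentence $I=(w_1,\dots,w_m)$ put $M_I=\sum_{1\le j_1<\dots<j_m}x_{w_1,j_1}\cdots x_{w_m,j_m}$, $M_1=1$. $\mathrm{QSym}_A$ is the span of the $M_I$; it is a subalgebra of $\Bbbk[x_A]$, isomorphic as an algebra to $(\mathrm{NSym}_A)^{gr}$ via $M_I\leftrightarrow H^*_I$. Doubling of variables: to $x_A$ add a copy $y_A=\{y_{a,i}\}$ (with the same relations among themselves), placed after the variables $x_A$, i.e. use the ordered index set $1<2<3<\dots<1'<2'<3'<\dots$ with $y_{a,i}=x_{a,i'}$; in particular every $x_{a,i}$ commutes with every $y_{b,j}$. For $f\in\mathrm{QSym}_A$, let $f(x,y)$ be the expansion of $f$ over this doubled ordered set of variables (for $M_I$: the same sum, over strictly increasing sequences in the doubled index set). Writing $f(x,y)=\sum_j f_j'(x)f_j''(y)$ with $f_j',f_j''\in\mathrm{QSym}_A$, one sets $\delta(f)=\sum_j f_j'\otimes f_j''$. *)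

theory Defs
  imports Complex_Main "HOL-Library.Function_Algebras" "HOL-Library.Multiset"
begin

section \<open>Vector spaces of functions and their tensor products\<close>

text \<open>
  All vector spaces below are subspaces of a space of functions \<open>'x \<Rightarrow> 'k\<close>: series are functions on
  monomials, and functionals on a space with a given basis are functions on that basis.
\<close>

definition scl :: "'k::field \<Rightarrow> ('x \<Rightarrow> 'k) \<Rightarrow> 'x \<Rightarrow> 'k" where
  "scl c f = (\<lambda>x. c * f x)"

interpretation fun_space: vector_space "scl :: 'k::field \<Rightarrow> ('x \<Rightarrow> 'k) \<Rightarrow> 'x \<Rightarrow> 'k"
  by unfold_locales (auto simp: scl_def algebra_simps fun_eq_iff)

text \<open>
  For \<open>V \<subseteq> 'x \<Rightarrow> 'k\<close> and \<open>W \<subseteq> 'y \<Rightarrow> 'k\<close>, the algebraic tensor product of \<open>V\<close> and \<open>W\<close> is realized inside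
  \<open>'x \<times> 'y \<Rightarrow> 'k\<close> by sending \<open>v \<otimes> w\<close> to \<open>(x, y) \<mapsto> v x * w y\<close>. The lemma
  \<open>tensor_eq_zeroD\<close> is the injectivity of this realization. An element of the tensor product is
  written as a finite sum of pure tensors, given by the list of its terms.
\<close>

definition tensor :: "('x \<Rightarrow> 'k::field) \<Rightarrow> ('y \<Rightarrow> 'k) \<Rightarrow> 'x \<times> 'y \<Rightarrow> 'k" (infixr \<open>\<otimes>\<close> 75) where
  "v \<otimes> w = (\<lambda>(x, y). v x * w y)"

definition tensor_sum :: "(('x \<Rightarrow> 'k::field) \<times> ('y \<Rightarrow> 'k)) list \<Rightarrow> 'x \<times> 'y \<Rightarrow> 'k" where
  "tensor_sum ps = (\<Sum>(v, w)\<leftarrow>ps. v \<otimes> w)"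

definition tensor_space ::
    "('x \<Rightarrow> 'k::field) set \<Rightarrow> ('y \<Rightarrow> 'k) set \<Rightarrow> ('x \<times> 'y \<Rightarrow> 'k) set" where
  "tensor_space V W = {tensor_sum ps |ps. set ps \<subseteq> V \<times> W}"

lemma sum_fun_apply: "(\<Sum>i\<in>S. f i) x = (\<Sum>i\<in>S. f i x)"
  by (induction S rule: infinite_finite_induct) auto

lemma tensor_eq_zeroD:
  assumes indep: "\<And>c. (\<Sum>i\<in>S. scl (c i) (w i)) = 0 \<Longrightarrow> \<forall>i\<in>S. c i = 0"
    and zero: "(\<Sum>i\<in>S. v i \<otimes> w i) = 0" and i: "i \<in> S"
  shows "v i = 0"
proof
  fix x
  have "(\<Sum>i\<in>S. scl (v i x) (w i)) y = 0" for y
    using fun_cong[OF zero, of "(x, y)"] by (simp add: sum_fun_apply scl_def tensor_def)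
  then have "(\<Sum>i\<in>S. scl (v i x) (w i)) = 0" by (simp add: fun_eq_iff)
  from indep[OF this] i show "v i x = 0 x" by simp
qed

definition linear_map_on ::
    "('x \<Rightarrow> 'k::field) set \<Rightarrow> (('x \<Rightarrow> 'k) \<Rightarrow> 'y \<Rightarrow> 'k) \<Rightarrow> bool" where
  "linear_map_on V F \<longleftrightarrow>
     (\<forall>f\<in>V. \<forall>g\<in>V. F (f + g) = F f + F g) \<and> (\<forall>c. \<forall>f\<in>V. F (scl c f) = scl c (F f))"

definition linear_form_on :: "('x \<Rightarrow> 'k::field) set \<Rightarrow> (('x \<Rightarrow> 'k) \<Rightarrow> 'k) \<Rightarrow> bool" where
  "linear_form_on V F \<longleftrightarrow>
     (\<forall>f\<in>V. \<forall>g\<in>V. F (f + g) = F f + F g) \<and> (\<forall>c. \<forall>f\<in>V. F (scl c f) = c * F f)"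


section \<open>Hopf algebras\<close>

record ('x, 'k) hopf_data =
  space :: "('x \<Rightarrow> 'k) set"
  mult :: "('x \<Rightarrow> 'k) \<Rightarrow> ('x \<Rightarrow> 'k) \<Rightarrow> 'x \<Rightarrow> 'k"
  unit :: "'x \<Rightarrow> 'k"
  comult :: "('x \<Rightarrow> 'k) \<Rightarrow> 'x \<times> 'x \<Rightarrow> 'k"
  counit :: "('x \<Rightarrow> 'k) \<Rightarrow> 'k"

definition is_algebra :: "('x, 'k::field) hopf_data \<Rightarrow> bool" where
  "is_algebra H \<longleftrightarrow>
     fun_space.subspace (space H) \<and>
     unit H \<in> space H \<and>
     (\<forall>f\<in>space H. \<forall>g\<in>space H. mult H f g \<in> space H) \<and>
     (\<forall>f\<in>space H. linear_map_on (space H) (\<lambda>g. mult H f g)) \<and>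
     (\<forall>g\<in>space H. linear_map_on (space H) (\<lambda>f. mult H f g)) \<and>
     (\<forall>f\<in>space H. \<forall>g\<in>space H. \<forall>h\<in>space H.
        mult H (mult H f g) h = mult H f (mult H g h)) \<and>
     (\<forall>f\<in>space H. mult H (unit H) f = f \<and> mult H f (unit H) = f)"

text \<open>\<open>ps\<close> is a decomposition of the coproduct of \<open>f\<close> as a sum of pure tensors (Sweedler notation).\<close>

definition decomposes ::
    "('x, 'k::field) hopf_data \<Rightarrow> ('x \<Rightarrow> 'k) \<Rightarrow> (('x \<Rightarrow> 'k) \<times> ('x \<Rightarrow> 'k)) list \<Rightarrow> bool" where
  "decomposes H f ps \<longleftrightarrow> set ps \<subseteq> space H \<times> space H \<and> comult H f = tensor_sum ps"

definition is_coalgebra :: "('x, 'k::field) hopf_data \<Rightarrow> bool" where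
  "is_coalgebra H \<longleftrightarrow>
     fun_space.subspace (space H) \<and>
     linear_map_on (space H) (comult H) \<and>
     linear_form_on (space H) (counit H) \<and>
     (\<forall>f\<in>space H. comult H f \<in> tensor_space (space H) (space H)) \<and>
     (\<forall>f\<in>space H. \<forall>ps. decomposes H f ps \<longrightarrow>
        (\<forall>x y z. (\<Sum>(v, w)\<leftarrow>ps. comult H v \<otimes> w) ((x, y), z) =
                 (\<Sum>(v, w)\<leftarrow>ps. v \<otimes> comult H w) (x, (y, z))) \<and>
        (\<Sum>(v, w)\<leftarrow>ps. scl (counit H v) w) = f \<and>
        (\<Sum>(v, w)\<leftarrow>ps. scl (counit H w) v) = f)"

definition is_bialgebra :: "('x, 'k::field) hopf_data \<Rightarrow> bool" where
  "is_bialgebra H \<longleftrightarrow>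
     is_algebra H \<and> is_coalgebra H \<and>
     comult H (unit H) = unit H \<otimes> unit H \<and>
     counit H (unit H) = 1 \<and>
     (\<forall>f\<in>space H. \<forall>g\<in>space H. \<forall>ps qs. decomposes H f ps \<longrightarrow> decomposes H g qs \<longrightarrow>
        comult H (mult H f g) =
          (\<Sum>(v, w)\<leftarrow>ps. \<Sum>(v', w')\<leftarrow>qs. mult H v v' \<otimes> mult H w w')) \<and>
     (\<forall>f\<in>space H. \<forall>g\<in>space H. counit H (mult H f g) = counit H f * counit H g)"

definition is_antipode ::
    "('x, 'k::field) hopf_data \<Rightarrow> (('x \<Rightarrow> 'k) \<Rightarrow> 'x \<Rightarrow> 'k) \<Rightarrow> bool" where
  "is_antipode H S \<longleftrightarrow>
     linear_map_on (space H) S \<and>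
     (\<forall>f\<in>space H. S f \<in> space H) \<and>
     (\<forall>f\<in>space H. \<forall>ps. decomposes H f ps \<longrightarrow>
        (\<Sum>(v, w)\<leftarrow>ps. mult H (S v) w) = scl (counit H f) (unit H) \<and>
        (\<Sum>(v, w)\<leftarrow>ps. mult H v (S w)) = scl (counit H f) (unit H))"

definition is_hopf_algebra :: "('x, 'k::field) hopf_data \<Rightarrow> bool" where
  "is_hopf_algebra H \<longleftrightarrow> is_bialgebra H \<and> (\<exists>S. is_antipode H S)"

definition algebra_iso ::
    "('x, 'k::field) hopf_data \<Rightarrow> ('y, 'k) hopf_data \<Rightarrow> (('x \<Rightarrow> 'k) \<Rightarrow> 'y \<Rightarrow> 'k) \<Rightarrow> bool" where
  "algebra_iso H K \<phi> \<longleftrightarrow>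
     bij_betw \<phi> (space H) (space K) \<and>
     linear_map_on (space H) \<phi> \<and>
     (\<forall>f\<in>space H. \<forall>g\<in>space H. \<phi> (mult H f g) = mult K (\<phi> f) (\<phi> g)) \<and>
     \<phi> (unit H) = unit K"

definition hopf_iso ::
    "('x, 'k::field) hopf_data \<Rightarrow> ('y, 'k) hopf_data \<Rightarrow> (('x \<Rightarrow> 'k) \<Rightarrow> 'y \<Rightarrow> 'k) \<Rightarrow> bool" where
  "hopf_iso H K \<phi> \<longleftrightarrow>
     is_hopf_algebra H \<and> is_hopf_algebra K \<and> algebra_iso H K \<phi> \<and>
     (\<forall>f\<in>space H. \<forall>ps. decomposes H f ps \<longrightarrow>
        comult K (\<phi> f) = (\<Sum>(v, w)\<leftarrow>ps. \<phi> v \<otimes> \<phi> w)) \<and>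
     (\<forall>f\<in>space H. counit K (\<phi> f) = counit H f) \<and>
     (\<forall>S T. is_antipode H S \<longrightarrow> is_antipode K T \<longrightarrow> (\<forall>f\<in>space H. \<phi> (S f) = T (\<phi> f)))"


section \<open>The Hopf algebra NSym and its graded dual\<close>

definition sentences :: "'a set \<Rightarrow> 'a list list set" where
  "sentences A = lists (lists A - {[]})"

definition sentence_size :: "'a list list \<Rightarrow> nat" where
  "sentence_size I = sum_list (map length I)"

definition strip :: "'a list list \<Rightarrow> 'a list list" where
  "strip I = filter (\<lambda>w. w \<noteq> []) I"

definition basis :: "'x \<Rightarrow> 'x \<Rightarrow> 'k::field" where
  "basis x = (\<lambda>y. if y = x then 1 else 0)"

abbreviation NSym_H :: "'a list list \<Rightarrow> 'a list list \<Rightarrow> 'k::field" where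
  "NSym_H \<equiv> basis"

text \<open>
  A sequence \<open>J = (v\<^sub>1, \<dots>, v\<^sub>m)\<close> with \<open>w\<^sub>i = u\<^sub>i v\<^sub>i\<close> is given by the list of the pairs
  \<open>(u\<^sub>i, v\<^sub>i)\<close>, so that \<open>I \ J\<close> and \<open>J\<close> are the lists of first and second components.
\<close>

definition NSym_comult_basis :: "'a list list \<Rightarrow> 'a list list \<times> 'a list list \<Rightarrow> 'k::field" where
  "NSym_comult_basis I =
     (\<Sum>uvs | map (\<lambda>(u, v). u @ v) uvs = I.
        NSym_H (strip (map fst uvs)) \<otimes> NSym_H (strip (map snd uvs)))"

text \<open>An element \<open>\<Sum>\<^sub>I c\<^sub>I H\<^sub>I\<close> of NSym is the finitely supported function \<open>I \<mapsto> c\<^sub>I\<close>.\<close>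

definition NSym :: "'a set \<Rightarrow> ('a list list, 'k::field) hopf_data" where
  "NSym A = \<lparr>
     space = {u. finite {I. u I \<noteq> 0} \<and> {I. u I \<noteq> 0} \<subseteq> sentences A},
     mult = (\<lambda>u v. \<Sum>I | u I \<noteq> 0. \<Sum>J | v J \<noteq> 0. scl (u I * v J) (NSym_H (I @ J))),
     unit = NSym_H [],
     comult = (\<lambda>u. \<Sum>I | u I \<noteq> 0. scl (u I) (NSym_comult_basis I)),
     counit = (\<lambda>u. u []) \<rparr>"

definition pairing :: "('x \<Rightarrow> 'k::field) \<Rightarrow> ('x \<Rightarrow> 'k) \<Rightarrow> 'k" where
  "pairing \<phi> u = (\<Sum>x | u x \<noteq> 0. \<phi> x * u x)"

text \<open>
  The graded dual of a Hopf algebra whose space consists of the finitely supported functions on a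
  set \<open>B\<close>, graded by \<open>deg\<close> on \<open>B\<close>. A functional is represented by its values on the basis \<open>B\<close>
  (and by \<open>0\<close> off \<open>B\<close>); it belongs to the graded dual if it vanishes in all large degrees. The
  operations are the transposes of those of \<open>H\<close> under \<open>pairing\<close>.
\<close>

definition graded_dual ::
    "'x set \<Rightarrow> ('x \<Rightarrow> nat) \<Rightarrow> ('x, 'k::field) hopf_data \<Rightarrow> ('x, 'k) hopf_data" where
  "graded_dual B deg H = \<lparr>
     space = {\<phi>. (\<forall>x. x \<notin> B \<longrightarrow> \<phi> x = 0) \<and> (\<exists>n. \<forall>x\<in>B. deg x > n \<longrightarrow> \<phi> x = 0)},
     mult = (\<lambda>\<phi> \<psi> x. if x \<in> B then pairing (\<phi> \<otimes> \<psi>) (comult H (basis x)) else 0),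
     unit = (\<lambda>x. if x \<in> B then counit H (basis x) else 0),
     comult = (\<lambda>\<phi> (x, y). if x \<in> B \<and> y \<in> B then pairing \<phi> (mult H (basis x) (basis y)) else 0),
     counit = (\<lambda>\<phi>. pairing \<phi> (unit H)) \<rparr>"

definition NSym_dual :: "'a set \<Rightarrow> ('a list list, 'k::field) hopf_data" where
  "NSym_dual A = graded_dual (sentences A) sentence_size (NSym A)"

text \<open>The functional dual to \<open>H\<^sub>I\<close>: it takes the value \<open>1\<close> at \<open>H\<^sub>I\<close> and \<open>0\<close> at the other \<open>H\<^sub>J\<close>.\<close>

abbreviation H_dual :: "'a list list \<Rightarrow> 'a list list \<Rightarrow> 'k::field" where
  "H_dual \<equiv> basis"


section \<open>Series in partially commutative variables\<close>

text \<open>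
  Monomials in variables \<open>x\<^sub>a\<^sub>,\<^sub>i\<close>, where \<open>x\<^sub>a\<^sub>,\<^sub>i\<close> and \<open>x\<^sub>b\<^sub>,\<^sub>j\<close> commute for \<open>i \<noteq> j\<close>:
  words in the letters \<open>(a, i)\<close> modulo the congruence generated by these relations.
\<close>

inductive pc_eq :: "('a \<times> 'i) list \<Rightarrow> ('a \<times> 'i) list \<Rightarrow> bool" where
  swap: "i \<noteq> j \<Longrightarrow> pc_eq (u @ [(a, i), (b, j)] @ v) (u @ [(b, j), (a, i)] @ v)"
| refl: "pc_eq u u"
| sym: "pc_eq u v \<Longrightarrow> pc_eq v u"
| trans: "pc_eq u v \<Longrightarrow> pc_eq v w \<Longrightarrow> pc_eq u w"

lemma pc_eq_append_left: "pc_eq u v \<Longrightarrow> pc_eq (t @ u) (t @ v)"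
proof (induction rule: pc_eq.induct)
  case (swap i j u a b v)
  then show ?case using pc_eq.swap[of i j "t @ u" a b v] by simp
qed (auto intro: pc_eq.intros)

lemma pc_eq_append_right: "pc_eq u v \<Longrightarrow> pc_eq (u @ t) (v @ t)"
proof (induction rule: pc_eq.induct)
  case (swap i j u a b v)
  then show ?case using pc_eq.swap[of i j u a b "v @ t"] by simp
qed (auto intro: pc_eq.intros)

lemma pc_eq_mset: "pc_eq u v \<Longrightarrow> mset u = mset v"
  by (induction rule: pc_eq.induct) auto

lemma pc_eq_map_index:
  assumes "inj h" shows "pc_eq u v \<Longrightarrow> pc_eq (map (map_prod id h) u) (map (map_prod id h) v)"
proof (induction rule: pc_eq.induct)
  case (swap i j u a b v)
  then have "h i \<noteq> h j" using assms by (auto dest: injD)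
  then show ?case
    using pc_eq.swap[of "h i" "h j" "map (map_prod id h) u" a b "map (map_prod id h) v"]
    by (simp add: id_def)
qed (auto intro: pc_eq.intros)

quotient_type ('a, 'i) pcmon = "('a \<times> 'i) list" / pc_eq
  by (rule equivpI) (auto simp: reflp_def symp_def transp_def intro: pc_eq.intros)

instantiation pcmon :: (type, type) monoid_mult
begin

lift_definition one_pcmon :: "('a, 'i) pcmon" is "[]" .

lift_definition times_pcmon :: "('a, 'i) pcmon \<Rightarrow> ('a, 'i) pcmon \<Rightarrow> ('a, 'i) pcmon" is "(@)"
  by (blast intro: pc_eq.trans pc_eq_append_left pc_eq_append_right)

instance
  by standard (transfer; simp add: pc_eq.refl)+

end

lift_definition pc_var :: "'a \<Rightarrow> 'i \<Rightarrow> ('a, 'i) pcmon" is "\<lambda>a i. [(a, i)]" .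

lift_definition pc_degree :: "('a, 'i) pcmon \<Rightarrow> nat" is length
  by (metis pc_eq_mset size_mset)

lift_definition pc_letters :: "('a, 'i) pcmon \<Rightarrow> 'a set" is "\<lambda>u. fst ` set u"
  by (metis pc_eq_mset set_mset_mset)

type_synonym ('a, 'i, 'k) pc_series = "('a, 'i) pcmon \<Rightarrow> 'k"

definition pc_mult ::
    "('a, 'i, 'k::field) pc_series \<Rightarrow> ('a, 'i, 'k) pc_series \<Rightarrow> ('a, 'i, 'k) pc_series" where
  "pc_mult f g = (\<lambda>m. \<Sum>(p, q) | p * q = m. f p * g q)"

lemma finite_factorizations: "finite {(p, q). p * q = (m :: ('a, 'i) pcmon)}"
proof -
  obtain w where w: "m = abs_pcmon w" by (metis Quotient3_abs_rep Quotient3_pcmon)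
  let ?L = "{u. set u \<subseteq> set w \<and> length u \<le> length w}"
  have "(p, q) \<in> (\<lambda>(u, v). (abs_pcmon u, abs_pcmon v)) ` (?L \<times> ?L)" if pq: "p * q = m" for p q
  proof -
    obtain u v where uv: "p = abs_pcmon u" "q = abs_pcmon v"
      by (metis Quotient3_abs_rep Quotient3_pcmon)
    have "pc_eq (u @ v) w" using pq w uv by (simp add: times_pcmon.abs_eq pcmon.abs_eq_iff)
    then have "mset (u @ v) = mset w" by (rule pc_eq_mset)
    then have "set (u @ v) = set w" "length (u @ v) = length w"
      by (metis set_mset_mset, metis size_mset)
    then have "u \<in> ?L" "v \<in> ?L" by auto
    then show ?thesis using uv by auto
  qed
  then have "{(p, q). p * q = m} \<subseteq> (\<lambda>(u, v). (abs_pcmon u, abs_pcmon v)) ` (?L \<times> ?L)" by blast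
  moreover have "finite ?L" by (rule finite_lists_length_le) simp
  ultimately show ?thesis by (meson finite_SigmaI finite_imageI finite_subset)
qed

text \<open>The series of bounded degree in the variables \<open>x\<^sub>a\<^sub>,\<^sub>i\<close> with \<open>a \<in> A\<close>.\<close>

definition bounded_series :: "'a set \<Rightarrow> ('a, 'i, 'k::field) pc_series set" where
  "bounded_series A = {f. \<exists>n. \<forall>m. f m \<noteq> 0 \<longrightarrow> pc_degree m \<le> n \<and> pc_letters m \<subseteq> A}"

definition word_mon :: "'a list \<Rightarrow> 'i \<Rightarrow> ('a, 'i) pcmon" where
  "word_mon w j = prod_list (map (\<lambda>a. pc_var a j) w)"

definition sentence_mon :: "'a list list \<Rightarrow> 'i list \<Rightarrow> ('a, 'i) pcmon" where
  "sentence_mon I js = prod_list (map2 word_mon I js)"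

text \<open>
  The infinite sum \<open>M\<^sub>I\<close> over \<open>j\<^sub>1 < \<dots> < j\<^sub>m\<close>, coefficientwise: the coefficient of a monomial
  is the number of index sequences which produce it (finite, the words of \<open>I\<close> being non-empty).
  The ordered set of indices is arbitrary, in order to allow for the doubling of variables.
\<close>

definition M :: "'a list list \<Rightarrow> ('a, 'i::linorder, 'k::field) pc_series" where
  "M I = (\<lambda>m. of_nat (card {js. sorted_wrt (<) js \<and> length js = length I \<and> sentence_mon I js = m}))"


section \<open>Doubling of variables and the Hopf algebra QSym\<close>

text \<open>
  The indices \<open>1 < 2 < 3 < \<dots>\<close> of the variables \<open>x\<close> are represented by the type \<open>nat\<close>, with its
  order (the numbering starts from \<open>0\<close>), and \<open>1 < 2 < \<dots> < 1' < 2' < \<dots>\<close> by \<open>dindex\<close>.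
\<close>

datatype dindex = Orig nat | Primed nat

instantiation dindex :: linorder
begin

fun less_eq_dindex :: "dindex \<Rightarrow> dindex \<Rightarrow> bool" where
  "less_eq_dindex (Orig i) (Orig j) \<longleftrightarrow> i \<le> j"
| "less_eq_dindex (Orig i) (Primed j) \<longleftrightarrow> True"
| "less_eq_dindex (Primed i) (Orig j) \<longleftrightarrow> False"
| "less_eq_dindex (Primed i) (Primed j) \<longleftrightarrow> i \<le> j"

definition less_dindex :: "dindex \<Rightarrow> dindex \<Rightarrow> bool" where
  "less_dindex i j \<longleftrightarrow> i \<le> j \<and> \<not> j \<le> i"

instance
proof
  fix i j k :: dindex
  show "i < j \<longleftrightarrow> i \<le> j \<and> \<not> j \<le> i" by (rule less_dindex_def)
  show "i \<le> i" by (cases i) auto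
  show "i \<le> j \<Longrightarrow> j \<le> k \<Longrightarrow> i \<le> k" by (cases i; cases j; cases k) auto
  show "i \<le> j \<Longrightarrow> j \<le> i \<Longrightarrow> i = j" by (cases i; cases j) auto
  show "i \<le> j \<or> j \<le> i" by (cases i; cases j) auto
qed

end

lift_definition mon_x :: "('a, nat) pcmon \<Rightarrow> ('a, dindex) pcmon" is "map (map_prod id Orig)"
  by (rule pc_eq_map_index) (auto simp: inj_def)

lift_definition mon_y :: "('a, nat) pcmon \<Rightarrow> ('a, dindex) pcmon" is "map (map_prod id Primed)"
  by (rule pc_eq_map_index) (auto simp: inj_def)

text \<open>The series \<open>f(x)\<close> and \<open>f(y)\<close> in the doubled variables.\<close>

definition series_x :: "('a, nat, 'k::field) pc_series \<Rightarrow> ('a, dindex, 'k) pc_series" where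
  "series_x f = (\<lambda>m. \<Sum>m' | mon_x m' = m. f m')"

definition series_y :: "('a, nat, 'k::field) pc_series \<Rightarrow> ('a, dindex, 'k) pc_series" where
  "series_y f = (\<lambda>m. \<Sum>m' | mon_y m' = m. f m')"

definition QSym_space :: "'a set \<Rightarrow> ('a, nat, 'k::field) pc_series set" where
  "QSym_space A = fun_space.span (M ` sentences A)"

text \<open>The expansion \<open>f(x, y)\<close>, obtained from the one of \<open>M\<^sub>I\<close> by linearity.\<close>

definition doubled :: "'a set \<Rightarrow> ('a, nat, 'k::field) pc_series \<Rightarrow> ('a, dindex, 'k) pc_series" where
  "doubled A f =
     (THE F. \<exists>S c. finite S \<and> S \<subseteq> sentences A \<and>
        f = (\<Sum>I\<in>S. scl (c I) (M I)) \<and> F = (\<Sum>I\<in>S. scl (c I) (M I)))"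

definition doubling_coproduct ::
    "'a set \<Rightarrow> ('a, nat, 'k::field) pc_series \<Rightarrow> ('a, nat) pcmon \<times> ('a, nat) pcmon \<Rightarrow> 'k" where
  "doubling_coproduct A f =
     (THE T. \<exists>ps. set ps \<subseteq> QSym_space A \<times> QSym_space A \<and>
        doubled A f = (\<Sum>(f', f'')\<leftarrow>ps. pc_mult (series_x f') (series_y f'')) \<and>
        T = tensor_sum ps)"

text \<open>The counit takes the constant term.\<close>

definition QSym :: "'a set \<Rightarrow> (('a, nat) pcmon, 'k::field) hopf_data" where
  "QSym A = \<lparr>
     space = QSym_space A,
     mult = pc_mult,
     unit = M [],
     comult = doubling_coproduct A,
     counit = (\<lambda>f. f 1) \<rparr>"

lemma word_mon_simps:
  "pc_degree (word_mon w j) = length w" "pc_letters (word_mon w j) = set w"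
proof -
  have "word_mon w j = abs_pcmon (map (\<lambda>a. (a, j)) w)"
    by (induction w)
      (simp_all add: word_mon_def pc_var.abs_eq one_pcmon.abs_eq times_pcmon.abs_eq)
  then show "pc_degree (word_mon w j) = length w" "pc_letters (word_mon w j) = set w"
    by (simp_all add: pc_degree.abs_eq pc_letters.abs_eq image_image)
qed

lemma pc_mult_simps:
  "pc_degree (1 :: ('a, 'i) pcmon) = 0" "pc_letters (1 :: ('a, 'i) pcmon) = {}"
  "pc_degree (p * q) = pc_degree p + pc_degree q" "pc_letters (p * q) = pc_letters p \<union> pc_letters q"
  by (transfer, auto)+

lemma sentence_mon_bounds:
  "length js = length I \<Longrightarrow>
     pc_degree (sentence_mon I js) = sentence_size I \<and> pc_letters (sentence_mon I js) = \<Union> (set ` set I)"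
  by (induction js I rule: list_induct2)
    (auto simp: sentence_mon_def sentence_size_def pc_mult_simps word_mon_simps)

lemma QSym_space_subset:
  "(QSym_space A :: ('a, nat, 'k::field) pc_series set) \<subseteq> bounded_series A"
  unfolding QSym_space_def
proof (rule fun_space.span_minimal)
  show "M ` sentences A \<subseteq> (bounded_series A :: ('a, nat, 'k) pc_series set)"
  proof (rule image_subsetI)
    fix I assume I: "I \<in> sentences A"
    have "pc_degree m \<le> sentence_size I \<and> pc_letters m \<subseteq> A"
      if nz: "(M I :: ('a, nat, 'k) pc_series) m \<noteq> 0" for m
    proof -
      from nz have "{js. sorted_wrt (<) js \<and> length js = length I \<and> sentence_mon I js = m} \<noteq> {}"
        unfolding M_def by (metis card.empty of_nat_0)
      then obtain js where "length js = length I" "sentence_mon I js = m" by auto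
      with sentence_mon_bounds[of js I] I show ?thesis by (auto simp: sentences_def)
    qed
    then show "(M I :: ('a, nat, 'k) pc_series) \<in> bounded_series A"
      by (auto simp: bounded_series_def)
  qed
  show "fun_space.subspace (bounded_series A :: ('a, nat, 'k) pc_series set)"
  proof (rule fun_space.subspaceI)
    fix f g :: "('a, nat, 'k) pc_series"
    assume "f \<in> bounded_series A" "g \<in> bounded_series A"
    then obtain k l where
      "\<forall>m. f m \<noteq> 0 \<longrightarrow> pc_degree m \<le> k \<and> pc_letters m \<subseteq> A"
      "\<forall>m. g m \<noteq> 0 \<longrightarrow> pc_degree m \<le> l \<and> pc_letters m \<subseteq> A"
      by (auto simp: bounded_series_def)
    then have "\<forall>m. (f + g) m \<noteq> 0 \<longrightarrow> pc_degree m \<le> max k l \<and> pc_letters m \<subseteq> A"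
      by (metis add.right_neutral le_max_iff_disj plus_fun_apply)
    then show "f + g \<in> bounded_series A" unfolding bounded_series_def by blast
  qed (auto simp: bounded_series_def scl_def)
qed

end

theory Submission
  imports Defs
begin

text \<open>
  Since variables with distinct indices commute, a monomial is determined by its words at the single
  indices; listing the non-empty ones by increasing index gives a sentence \<open>word_seq m\<close>. The
  coefficient of \<open>m\<close> in \<open>M\<^sub>I\<close> is then \<open>1\<close> if \<open>word_seq m = I\<close> and \<open>0\<close> otherwise, so QSym is the
  pullback of the graded dual of NSym along \<open>word_seq\<close>. Factoring a monomial amounts to splitting
  each of its words in two, which is the transpose of the coproduct of NSym. A monomial in the doubled
  variables is uniquely \<open>p(x) q(y)\<close>, and its sentence is \<open>word_seq p @ word_seq q\<close>; hence doubling
  the variables is deconcatenation. The antipode of NSym is the antihomomorphism with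
  \<open>S(H(w)) = \<Sum>(-1)\<^sup>k H(u\<^sub>1, \<dots>, u\<^sub>k)\<close> over the factorizations of \<open>w\<close> into non-empty words \<open>u\<^sub>i\<close>.
\<close>

section \<open>Partially commutative monomials and sentences\<close>

text \<open>\<open>word_seq\<close> keeps the order of the indices that carry words but forgets
  their values, so it identifies many monomials. Pulling back along it is still injective on the
  dual, because \<open>nat\<close> has enough indices for every sentence. Identities can therefore
  be checked on the easier side: associativity of the dual product is read off from series, while
  coproduct, counit and antipode are computed on sentences and transported. The definitions create
  three obligations. The Hopf axioms are demanded of every decomposition of a coproduct into pure
  tensors; such a decomposition is exploited through the identity that the sum of
  \<open>v I * w J\<close> over its terms is \<open>f (I @ J)\<close>. Both \<open>f(x, y)\<close>
  and its coproduct are definite descriptions; linear independence of the \<open>M I\<close> and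
  unique factorization of doubled monomials make them well defined. And \<open>hopf_iso\<close>
  speaks of all antipodes, so uniqueness of the antipode is required. Finiteness of \<open>A\<close>
  makes each degree finite-dimensional: elements of the graded dual are finite combinations of the
  dual basis, and the coproduct lands in the algebraic tensor product.\<close>

lift_definition pc_word :: "('a, 'i) pcmon \<Rightarrow> 'i \<Rightarrow> 'a list"
  is "\<lambda>u i. map fst (filter (\<lambda>p. snd p = i) u)"
proof
  fix u v :: "('a \<times> 'i) list" and i
  show "pc_eq u v \<Longrightarrow> map fst (filter (\<lambda>p. snd p = i) u) = map fst (filter (\<lambda>p. snd p = i) v)"
    by (induction rule: pc_eq.induct) auto
qed

lemma pc_word_one [simp]: "pc_word 1 i = []"
  by transfer simp

lemma pc_word_mult [simp]: "pc_word (p * q) i = pc_word p i @ pc_word q i"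
  by transfer simp

lemma pc_word_var [simp]: "pc_word (pc_var a j) i = (if i = j then [a] else [])"
  by transfer simp

lemma pc_word_word_mon [simp]: "pc_word (word_mon w j) i = (if i = j then w else [])"
  by (induction w) (auto simp: word_mon_def)

lemma pc_eq_move_front:
  "\<forall>p\<in>set u. snd p \<noteq> i \<Longrightarrow> pc_eq (u @ (a, i) # v) ((a, i) # u @ v)"
proof (induction u)
  case (Cons p u)
  obtain b j where p: "p = (b, j)" by (cases p)
  from Cons have "pc_eq ([p] @ (u @ (a, i) # v)) ([p] @ ((a, i) # u @ v))"
    by (intro pc_eq_append_left) simp
  moreover have "pc_eq ([] @ [(b, j), (a, i)] @ (u @ v)) ([] @ [(a, i), (b, j)] @ (u @ v))"
    using Cons.prems p by (intro pc_eq.swap) auto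
  ultimately show ?case using p by (auto intro: pc_eq.trans)
qed (simp add: pc_eq.refl)

text \<open>The first letter \<open>(a, i)\<close> of \<open>u\<close> must also be the first letter
  of index \<open>i\<close> in \<open>v\<close>. It commutes with everything that stands before it
  there, so it can be moved to the front of \<open>v\<close> and cancelled.\<close>

lemma pc_eq_if_same_words:
  "(\<And>i. map fst (filter (\<lambda>p. snd p = i) u) = map fst (filter (\<lambda>p. snd p = i) v)) \<Longrightarrow> pc_eq u v"
proof (induction u arbitrary: v)
  case Nil
  have "v = []"
  proof (cases v)
    case (Cons p v') with Nil[of "snd p"] show ?thesis by simp
  qed
  then show ?case by (simp add: pc_eq.refl)
next
  case (Cons p u)
  obtain a i where p: "p = (a, i)" by (cases p)
  have *: "map fst (filter (\<lambda>p. snd p = i) v) = a # map fst (filter (\<lambda>p. snd p = i) u)"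
    using Cons.prems[of i] p by simp
  then obtain q qs where "filter (\<lambda>p. snd p = i) v = q # qs" by (metis list.map_disc_iff neq_Nil_conv)
  then obtain v1 v2 where v: "v = v1 @ q # v2" "\<forall>p\<in>set v1. snd p \<noteq> i" "snd q = i"
    by (auto simp: filter_eq_Cons_iff)
  have f1: "filter (\<lambda>p. snd p = i) v1 = []" using v(2) by (simp add: filter_empty_conv)
  from * v f1 have q: "q = (a, i)" by (cases q) auto
  have "pc_eq u (v1 @ v2)"
  proof (rule Cons.IH)
    fix j
    show "map fst (filter (\<lambda>p. snd p = j) u) = map fst (filter (\<lambda>p. snd p = j) (v1 @ v2))"
      using Cons.prems[of j] p v(1) q f1 by (cases "i = j") auto
  qed
  then have "pc_eq ([p] @ u) ([p] @ v1 @ v2)" by (rule pc_eq_append_left)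
  moreover have "pc_eq v (p # v1 @ v2)" using pc_eq_move_front[OF v(2)] v(1) q p by simp
  ultimately show ?case by (auto intro: pc_eq.trans pc_eq.sym)
qed

lemma pcmon_eqI: "(\<And>i. pc_word p i = pc_word q i) \<Longrightarrow> p = q"
  by transfer (rule pc_eq_if_same_words)

definition pc_support :: "('a, 'i) pcmon \<Rightarrow> 'i set" where
  "pc_support m = {i. pc_word m i \<noteq> []}"

lemma finite_pc_support [simp]: "finite (pc_support m)"
proof -
  obtain u where u: "m = abs_pcmon u" by (metis Quotient3_abs_rep Quotient3_pcmon)
  have "pc_support m \<subseteq> snd ` set u"
    by (auto simp: pc_support_def u pc_word.abs_eq filter_empty_conv)
  then show ?thesis by (rule finite_subset) simp
qed

lemma sorted_list_of_set_eqI: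
  "sorted_wrt (<) js \<Longrightarrow> S = set js \<Longrightarrow> sorted_list_of_set S = js"
  by (simp add: strict_sorted_iff sorted_list_of_set.idem_if_sorted_distinct)

definition word_seq :: "('a, 'i::linorder) pcmon \<Rightarrow> 'a list list" where
  "word_seq m = map (pc_word m) (sorted_list_of_set (pc_support m))"

lemma pc_word_sentence_mon_notin [simp]:
  "i \<notin> set js \<Longrightarrow> pc_word (sentence_mon I js) i = []"
proof (induction I arbitrary: js)
  case (Cons w I)
  then show ?case by (cases js) (auto simp: sentence_mon_def)
qed (simp add: sentence_mon_def)

lemma map_pc_word_sentence_mon:
  "length js = length I \<Longrightarrow> distinct js \<Longrightarrow> map (pc_word (sentence_mon I js)) js = I"
proof (induction js I rule: list_induct2)
  case (Cons j js w I)
  have eq: "sentence_mon (w # I) (j # js) = word_mon w j * sentence_mon I js"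
    by (simp add: sentence_mon_def)
  have "map (pc_word (sentence_mon (w # I) (j # js))) js = map (pc_word (sentence_mon I js)) js"
    using Cons.prems by (auto simp: eq)
  also have "\<dots> = I" using Cons by simp
  finally have "map (pc_word (sentence_mon (w # I) (j # js))) js = I" .
  moreover have "pc_word (sentence_mon (w # I) (j # js)) j = w" using Cons.prems by (simp add: eq)
  ultimately show ?case by (simp only: list.map)
qed simp

text \<open>Words of \<open>I\<close> may be empty here; their indices then lie outside the support,
  hence \<open>strip\<close>. This generality is needed when \<open>I\<close> is one component of a
  splitting, as in \<open>sum_factorizations\<close>.\<close>

lemma word_seq_sentence_mon:
  fixes js :: "'i::linorder list"
  assumes "length js = length I" "sorted_wrt (<) js"
  shows "word_seq (sentence_mon I js) = strip I"
proof -
  let ?m = "sentence_mon I js"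
  have d: "distinct js" using assms(2) by (simp add: strict_sorted_iff)
  have "pc_support ?m = set (filter (\<lambda>j. pc_word ?m j \<noteq> []) js)"
    by (auto simp: pc_support_def intro: ccontr)
  then have "sorted_list_of_set (pc_support ?m) = filter (\<lambda>j. pc_word ?m j \<noteq> []) js"
    using assms(2) by (intro sorted_list_of_set_eqI sorted_wrt_filter)
  then have "word_seq ?m = filter (\<lambda>w. w \<noteq> []) (map (pc_word ?m) js)"
    by (simp add: word_seq_def filter_map o_def)
  then show ?thesis using map_pc_word_sentence_mon[OF assms(1) d] by (simp add: strip_def)
qed

text \<open>The list \<open>js\<close> may contain more than the support of \<open>m\<close>, so
  both factors of a monomial can be written over the index list of their product.\<close>

lemma sentence_mon_eqI:
  assumes "distinct js" "\<And>i. i \<notin> set js \<Longrightarrow> pc_word m i = []"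
  shows "sentence_mon (map (pc_word m) js) js = m"
proof (rule pcmon_eqI)
  fix i
  show "pc_word (sentence_mon (map (pc_word m) js) js) i = pc_word m i"
  proof (cases "i \<in> set js")
    case True
    with map_pc_word_sentence_mon[of js "map (pc_word m) js"] assms(1) show ?thesis
      by (simp add: map_eq_conv)
  qed (use assms in simp)
qed

lemma sentence_mon_word_seq: "sentence_mon (word_seq m) (sorted_list_of_set (pc_support m)) = m"
  unfolding word_seq_def
proof (rule sentence_mon_eqI)
  fix i assume "i \<notin> set (sorted_list_of_set (pc_support m))"
  then show "pc_word m i = []" by (simp add: pc_support_def[of m] finite_pc_support[unfolded pc_support_def])
qed simp

lemma pc_word_surj:
  fixes g :: "'i::linorder \<Rightarrow> 'a list"
  assumes "finite {i. g i \<noteq> []}"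
  obtains m where "\<And>i. pc_word m i = g i"
proof
  let ?js = "sorted_list_of_set {i. g i \<noteq> []}"
  fix i
  show "pc_word (sentence_mon (map g ?js) ?js) i = g i"
  proof (cases "i \<in> set ?js")
    case True
    with map_pc_word_sentence_mon[of ?js "map g ?js"] show ?thesis by (simp add: map_eq_conv)
  next
    case False
    with assms show ?thesis by simp
  qed
qed

lemma Nil_notin_word_seq: "[] \<notin> set (word_seq m)"
  using finite_pc_support[of m] by (auto simp: word_seq_def pc_support_def)

lemma strip_id: "[] \<notin> set I \<Longrightarrow> strip I = I"
  unfolding strip_def by (rule filter_True) auto

lemma range_word_seq: "range (word_seq :: ('a, nat) pcmon \<Rightarrow> _) = {I. [] \<notin> set I}"
proof
  show "range (word_seq :: ('a, nat) pcmon \<Rightarrow> _) \<subseteq> {I. [] \<notin> set I}"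
    using Nil_notin_word_seq by blast
  show "{I. [] \<notin> set I} \<subseteq> range (word_seq :: ('a, nat) pcmon \<Rightarrow> _)"
  proof
    fix I :: "'a list list" assume "I \<in> {I. [] \<notin> set I}"
    \<comment> \<open>The supply of indices being infinite, the words of \<open>I\<close> can simply
      be placed at the first \<open>length I\<close> of them.\<close>
    then have "word_seq (sentence_mon I [0..<length I]) = I"
      by (simp add: word_seq_sentence_mon strip_id)
    then show "I \<in> range (word_seq :: ('a, nat) pcmon \<Rightarrow> _)" by (metis rangeI)
  qed
qed

text \<open>As no word of \<open>I\<close> is empty, an index sequence producing \<open>m\<close>
  has to list the support of \<open>m\<close> exactly, so there is at most one. The index order is
  arbitrary because the result serves both \<open>nat\<close> and \<open>dindex\<close>.\<close>

lemma M_eq_basis_word_seq: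
  fixes I :: "'a list list"
  assumes "[] \<notin> set I"
  shows "(M I :: ('a, 'i::linorder, 'k::field) pc_series) = basis I \<circ> word_seq"
proof
  fix m :: "('a, 'i) pcmon"
  let ?S = "{js. sorted_wrt (<) js \<and> length js = length I \<and> sentence_mon I js = m}"
  have "?S = (if word_seq m = I then {sorted_list_of_set (pc_support m)} else {})"
  proof (intro set_eqI iffI)
    fix js assume js: "js \<in> ?S"
    then have ws: "word_seq m = I" using word_seq_sentence_mon[of js I] assms by (auto simp: strip_id)
    have "map (pc_word m) js = I"
      using js map_pc_word_sentence_mon[of js I] by (auto simp: strict_sorted_iff)
    then have "set js \<subseteq> pc_support m" using assms by (force simp: pc_support_def)
    moreover have "pc_support m \<subseteq> set js"
      using js by (auto simp: pc_support_def intro: ccontr)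
    ultimately have "js = sorted_list_of_set (pc_support m)"
      using js by (intro sorted_list_of_set_eqI[symmetric]) auto
    with ws show "js \<in> (if word_seq m = I then {sorted_list_of_set (pc_support m)} else {})" by simp
  next
    fix js assume "js \<in> (if word_seq m = I then {sorted_list_of_set (pc_support m)} else {})"
    then have "word_seq m = I" "js = sorted_list_of_set (pc_support m)" by (auto split: if_splits)
    then show "js \<in> ?S" using sentence_mon_word_seq[of m] by (auto simp: word_seq_def)
  qed
  then show "M I m = (basis I \<circ> word_seq) m" by (simp add: M_def basis_def)
qed

section \<open>Factorizations of a monomial and splittings of its sentence\<close>

definition splits :: "'a list list \<Rightarrow> ('a list \<times> 'a list) list set" where
  "splits I = {uvs. map (\<lambda>(u, v). u @ v) uvs = I}"

text \<open>To factor \<open>m\<close> is to cut, independently at each index of its support, the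
  word there into a prefix and a suffix; at other indices both factors have the empty word. A cut at
  an end of a word leaves an empty word in one factor, which \<open>word_seq\<close> does not see,
  hence \<open>strip\<close>.\<close>

lemma sum_factorizations:
  fixes m :: "('a, 'i::linorder) pcmon"
  shows "(\<Sum>(p, q) | p * q = m. F (word_seq p) (word_seq q)) =
    (\<Sum>uvs\<in>splits (word_seq m). F (strip (map fst uvs)) (strip (map snd uvs)))"
proof -
  define js where "js = sorted_list_of_set (pc_support m)"
  have js: "sorted_wrt (<) js" "distinct js" by (simp_all add: js_def)
  have m0: "pc_word m i = []" if "i \<notin> set js" for i
    using that by (simp add: js_def pc_support_def[of m] finite_pc_support[unfolded pc_support_def])
  have ws: "word_seq m = map (pc_word m) js" by (simp add: js_def word_seq_def)
  let ?i = "\<lambda>uvs. (sentence_mon (map fst uvs) js, sentence_mon (map snd uvs) js)"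
  let ?j = "\<lambda>(p, q). map (\<lambda>j. (pc_word p j, pc_word q j)) js"
  have len: "length uvs = length js" if "uvs \<in> splits (word_seq m)" for uvs
    using that by (auto simp: splits_def ws dest: arg_cong[where f = length])
  show ?thesis
  proof (rule sum.reindex_bij_witness[where i = ?i and j = ?j])
    fix pq assume "pq \<in> {(p, q). p * q = m}"
    then obtain p q where pq: "pq = (p, q)" "p * q = m" by auto
    have 0: "pc_word p i = []" "pc_word q i = []" if "i \<notin> set js" for i
      using m0[OF that] pq(2) by auto
    then have eq: "sentence_mon (map (pc_word p) js) js = p" "sentence_mon (map (pc_word q) js) js = q"
      by (simp_all add: sentence_mon_eqI js)
    then show "?i (?j pq) = pq" by (simp add: pq o_def)
    show "?j pq \<in> splits (word_seq m)"
      using pq by (auto simp: splits_def ws)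
    show "F (strip (map fst (?j pq))) (strip (map snd (?j pq))) = (case pq of (p, q) \<Rightarrow> F (word_seq p) (word_seq q))"
      using word_seq_sentence_mon[OF _ js(1), of "map (pc_word p) js"]
        word_seq_sentence_mon[OF _ js(1), of "map (pc_word q) js"]
      by (simp add: pq eq o_def)
  next
    fix uvs assume uvs: "uvs \<in> splits (word_seq m)"
    note l = len[OF this]
    have w: "map (pc_word (sentence_mon (map fst uvs) js)) js = map fst uvs"
      "map (pc_word (sentence_mon (map snd uvs) js)) js = map snd uvs"
      using l js by (simp_all add: map_pc_word_sentence_mon)
    have z: "map (\<lambda>j. (f j, g j)) js = zip (map f js) (map g js)" for f :: "'i \<Rightarrow> 'a list" and g :: "'i \<Rightarrow> 'a list"
      by (induction js) auto
    show "?j (?i uvs) = uvs" by (simp add: z w zip_map_fst_snd)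
    have *: "map (pc_word (sentence_mon (map fst uvs) js * sentence_mon (map snd uvs) js)) js = map (pc_word m) js"
    proof -
      have "map (\<lambda>(u, v). u @ v) (?j (?i uvs)) = map (pc_word m) js"
        unfolding \<open>?j (?i uvs) = uvs\<close> using uvs by (simp add: splits_def ws)
      then show ?thesis by (simp add: o_def)
    qed
    have "sentence_mon (map fst uvs) js * sentence_mon (map snd uvs) js = m"
    proof (rule pcmon_eqI)
      fix i
      show "pc_word (sentence_mon (map fst uvs) js * sentence_mon (map snd uvs) js) i = pc_word m i"
        using * m0 by (cases "i \<in> set js") (simp_all add: map_eq_conv)
    qed
    then show "?i uvs \<in> {(p, q). p * q = m}" by simp
  qed
qed

lemma pc_mult_assoc:
  fixes f g h :: "('a, 'i, 'k::field) pc_series"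
  shows "pc_mult (pc_mult f g) h = pc_mult f (pc_mult g h)"
proof
  fix m
  let ?F = "\<lambda>m::('a, 'i) pcmon. {(p, q). p * q = m}"
  have "pc_mult (pc_mult f g) h m = (\<Sum>(n, r)\<in>?F m. \<Sum>(p, q)\<in>?F n. f p * g q * h r)"
    by (simp add: pc_mult_def sum_distrib_right case_prod_unfold)
  also have "\<dots> = (\<Sum>((n, r), (p, q))\<in>(SIGMA (n, r):?F m. ?F n). f p * g q * h r)"
    by (subst sum.Sigma[symmetric]) (auto simp: finite_factorizations[unfolded case_prod_unfold] case_prod_unfold)
  \<comment> \<open>Both sums run over the factorizations of \<open>m\<close> into three factors
    \<open>p * q * r\<close>, bracketed differently.\<close>
  also have "\<dots> = (\<Sum>((p, n), (q, r))\<in>(SIGMA (p, n):?F m. ?F n). f p * g q * h r)"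
    by (rule sum.reindex_bij_witness[where
          i = "\<lambda>((p, n), (q, r)). ((p * q, r), (p, q))" and j = "\<lambda>((n, r), (p, q)). ((p, q * r), (q, r))"])
      (auto simp: mult.assoc)
  also have "\<dots> = (\<Sum>(p, n)\<in>?F m. \<Sum>(q, r)\<in>?F n. f p * g q * h r)"
    by (subst sum.Sigma[symmetric]) (auto simp: finite_factorizations[unfolded case_prod_unfold] case_prod_unfold)
  also have "\<dots> = pc_mult f (pc_mult g h) m"
    by (simp add: pc_mult_def sum_distrib_left case_prod_unfold mult.assoc)
  finally show "pc_mult (pc_mult f g) h m = pc_mult f (pc_mult g h) m" .
qed

section \<open>Monomials and series in the doubled variables\<close>

lemma pc_word_mon_x [simp]:
  "pc_word (mon_x p) (Orig i) = pc_word p i" "pc_word (mon_x p) (Primed i) = []"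
  by (transfer, simp add: filter_map o_def)+

lemma pc_word_mon_y [simp]:
  "pc_word (mon_y p) (Orig i) = []" "pc_word (mon_y p) (Primed i) = pc_word p i"
  by (transfer, simp add: filter_map o_def)+

lemma mon_x_y_cancel: "mon_x p * mon_y q = mon_x p' * mon_y q' \<longleftrightarrow> p = p' \<and> q = q'"
proof
  assume *: "mon_x p * mon_y q = mon_x p' * mon_y q'"
  have "pc_word p i = pc_word p' i" "pc_word q i = pc_word q' i" for i
    using arg_cong[OF *, of "\<lambda>m. pc_word m (Orig i)"] arg_cong[OF *, of "\<lambda>m. pc_word m (Primed i)"] by simp_all
  then show "p = p' \<and> q = q'" by (auto intro: pcmon_eqI)
qed simp

text \<open>The words at the \<open>Orig\<close> indices make up \<open>p\<close>, those at the
  \<open>Primed\<close> indices make up \<open>q\<close>; letters of the two kinds commute, so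
  nothing else of \<open>m\<close> has to be remembered.\<close>

lemma ex_mon_x_y: "\<exists>p q. m = mon_x p * mon_y q"
proof -
  have "finite (Orig -` pc_support m)" "finite (Primed -` pc_support m)"
    by (auto intro!: finite_vimageI simp: inj_def)
  then have "finite {i. pc_word m (Orig i) \<noteq> []}" "finite {i. pc_word m (Primed i) \<noteq> []}"
    by (simp_all add: pc_support_def vimage_def)
  then obtain p q where "\<And>i. pc_word p i = pc_word m (Orig i)" "\<And>i. pc_word q i = pc_word m (Primed i)"
    by (metis pc_word_surj)
  then have "pc_word m i = pc_word (mon_x p * mon_y q) i" for i by (cases i) simp_all
  then show ?thesis by (blast intro: pcmon_eqI)
qed

lemma less_dindex_simps [simp]:
  "Orig i < Orig j \<longleftrightarrow> i < j" "Orig i < Primed j" "\<not> Primed i < Orig j" "Primed i < Primed j \<longleftrightarrow> i < j"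
  by (auto simp: less_dindex_def)

text \<open>Every \<open>Orig\<close> index precedes every \<open>Primed\<close> one, so the
  increasing enumeration of the support lists all of \<open>p\<close> before all of
  \<open>q\<close>. Here the order of the doubled index set produces concatenation.\<close>

lemma word_seq_mon_x_y: "word_seq (mon_x p * mon_y q) = word_seq p @ word_seq q"
proof -
  let ?js = "map Orig (sorted_list_of_set (pc_support p)) @ map Primed (sorted_list_of_set (pc_support q))"
  have "i \<in> pc_support (mon_x p * mon_y q) \<longleftrightarrow> i \<in> set ?js" for i
    by (cases i) (auto simp: pc_support_def[of "mon_x p * mon_y q"] pc_support_def[of p] pc_support_def[of q]
        finite_pc_support[unfolded pc_support_def])
  then have "pc_support (mon_x p * mon_y q) = set ?js" by blast
  moreover have "sorted_wrt (<) ?js"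
    by (auto simp: sorted_wrt_append sorted_wrt_map)
  ultimately have "sorted_list_of_set (pc_support (mon_x p * mon_y q)) = ?js"
    by (intro sorted_list_of_set_eqI)
  then show ?thesis by (simp add: word_seq_def o_def)
qed

lemma mon_x_inject: "mon_x p = mon_x q \<longleftrightarrow> p = q"
  by (metis mon_x_y_cancel)

lemma mon_y_inject: "mon_y p = mon_y q \<longleftrightarrow> p = q"
  by (metis mon_x_y_cancel)

lemma series_x_mon_x: "series_x f (mon_x p) = f p"
  by (simp add: series_x_def mon_x_inject)

lemma series_y_mon_y: "series_y f (mon_y p) = f p"
  by (simp add: series_y_def mon_y_inject)

lemma series_x_nonzeroD: "series_x f m \<noteq> 0 \<Longrightarrow> \<exists>p. m = mon_x p"
  unfolding series_x_def by (metis (mono_tags, lifting) mem_Collect_eq sum.neutral)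

lemma series_y_nonzeroD: "series_y f m \<noteq> 0 \<Longrightarrow> \<exists>p. m = mon_y p"
  unfolding series_y_def by (metis (mono_tags, lifting) mem_Collect_eq sum.neutral)

text \<open>By unique factorization only the pair \<open>(mon_x p, mon_y q)\<close> contributes.
  Thus the coefficients of \<open>f(x) g(y)\<close> are the values of \<open>f \<otimes> g\<close>,
  and a tensor can be recovered from its image among the doubled series.\<close>

lemma pc_mult_series_x_y:
  "pc_mult (series_x f) (series_y g) (mon_x p * mon_y q) = f p * g q"
proof -
  let ?P = "{(p', q'). p' * q' = mon_x p * mon_y q}"
  have "(p', q') = (mon_x p, mon_y q)"
    if pq: "(p', q') \<in> ?P" "series_x f p' \<noteq> 0" "series_y g q' \<noteq> 0" for p' q'
  proof -
    obtain p'' q'' where "p' = mon_x p''" "q' = mon_y q''"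
      using pq series_x_nonzeroD series_y_nonzeroD by blast
    with pq(1) show ?thesis by (simp add: mon_x_y_cancel)
  qed
  then have 0: "\<forall>pq\<in>?P - {(mon_x p, mon_y q)}. (case pq of (p', q') \<Rightarrow> series_x f p' * series_y g q') = 0"
    by (metis (no_types, lifting) DiffE case_prod_conv insertI1 mult_eq_0_iff surj_pair)
  have "pc_mult (series_x f) (series_y g) (mon_x p * mon_y q) =
    (\<Sum>(p', q')\<in>{(mon_x p, mon_y q)}. series_x f p' * series_y g q')"
    unfolding pc_mult_def by (rule sum.mono_neutral_right[OF _ _ 0]) (auto simp: finite_factorizations)
  then show ?thesis by (simp add: series_x_mon_x series_y_mon_y)
qed

section \<open>The graded dual of NSym as a bialgebra\<close>

lemma sum_list_fun_apply: "(\<Sum>p\<leftarrow>ps. f p) x = (\<Sum>p\<leftarrow>ps. f p x)"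
  by (induction ps) auto

lemma tensor_sum_apply: "tensor_sum ps (x, y) = (\<Sum>(v, w)\<leftarrow>ps. v x * w y)"
  by (simp add: tensor_sum_def sum_list_fun_apply tensor_def case_prod_unfold)

lemma sum_list_sum_swap: "(\<Sum>p\<leftarrow>ps. \<Sum>x\<in>S. f p x) = (\<Sum>x\<in>S. \<Sum>p\<leftarrow>ps. f p x)"
  for f :: "'b \<Rightarrow> 'c \<Rightarrow> 'd::comm_monoid_add"
  by (induction ps) (auto simp: sum.distrib)

lemma sum_list_mult_sum_list:
  "(\<Sum>x\<leftarrow>xs. f x) * (\<Sum>y\<leftarrow>ys. g y) = (\<Sum>x\<leftarrow>xs. \<Sum>y\<leftarrow>ys. f x * g y)"
  for f :: "'b \<Rightarrow> 'd::semiring_0"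
  by (induction xs) (auto simp: distrib_right sum_list_const_mult)

lemma append_eq_conv_image:
  "{(u, v). u @ v = w} = (\<lambda>j. (take j w, drop j w)) ` {0..length w}"
proof (intro set_eqI iffI)
  fix p assume "p \<in> {(u, v). u @ v = w}"
  then have "p = (\<lambda>j. (take j w, drop j w)) (length (fst p))" "length (fst p) \<in> {0..length w}" by auto
  then show "p \<in> (\<lambda>j. (take j w, drop j w)) ` {0..length w}" by (rule image_eqI)
qed auto

lemma finite_append_eq [simp]: "finite {(u, v). u @ v = w}"
  by (simp add: append_eq_conv_image)

text \<open>A prefix of \<open>w\<close> is determined by its length; this links the two forms in
  which deconcatenation is written.\<close>

lemma sum_append_eq: "(\<Sum>(u, v) | u @ v = w. F u v) = (\<Sum>j = 0..length w. F (take j w) (drop j w))"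
proof -
  have "inj_on (\<lambda>j. (take j w, drop j w)) {0..length w}"
    by (rule inj_on_inverseI[where g = "\<lambda>(u, v). length u"]) auto
  then show ?thesis
    unfolding append_eq_conv_image by (simp add: sum.reindex)
qed

section \<open>Left and right parts of a splitting\<close>

abbreviation lpart :: "('a list \<times> 'a list) list \<Rightarrow> 'a list list" where
  "lpart uvs \<equiv> strip (map fst uvs)"

abbreviation rpart :: "('a list \<times> 'a list) list \<Rightarrow> 'a list list" where
  "rpart uvs \<equiv> strip (map snd uvs)"

lemma strip_append [simp]: "strip (I @ J) = strip I @ strip J"
  by (simp add: strip_def)

lemma strip_Nil [simp]: "strip [] = []"
  by (simp add: strip_def)

lemma strip_Cons: "strip (w # I) = strip [w] @ strip I"
  by (simp add: strip_def)

lemma strip_single [simp]: "strip [[]] = []" "w \<noteq> [] \<Longrightarrow> strip [w] = [w]"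
  by (simp_all add: strip_def)

lemma splits_Nil [simp]: "splits [] = {[]}"
  by (auto simp: splits_def)

lemma splits_Cons: "splits (w # I) = (\<lambda>(p, uvs). p # uvs) ` ({(u, v). u @ v = w} \<times> splits I)"
  by (fastforce simp: splits_def map_eq_Cons_conv image_iff)

lemma finite_splits [simp]: "finite (splits I)"
  by (induction I) (simp_all add: splits_Cons)

lemma sum_splits_Cons:
  "(\<Sum>uvs\<in>splits (w # I). F uvs) = (\<Sum>(u, v) | u @ v = w. \<Sum>uvs\<in>splits I. F ((u, v) # uvs))"
proof -
  have "(\<Sum>uvs\<in>splits (w # I). F uvs) = (\<Sum>(p, uvs)\<in>{(u, v). u @ v = w} \<times> splits I. F (p # uvs))"
    unfolding splits_Cons by (subst sum.reindex) (auto simp: inj_on_def case_prod_unfold o_def)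
  also have "\<dots> = (\<Sum>p\<in>{(u, v). u @ v = w}. \<Sum>uvs\<in>splits I. F (p # uvs))"
    by (rule sum.cartesian_product[symmetric])
  finally show ?thesis by (simp add: case_prod_unfold)
qed

lemma sum_splits_append:
  "(\<Sum>uvs\<in>splits (I @ J). F uvs) = (\<Sum>a\<in>splits I. \<Sum>b\<in>splits J. F (a @ b))"
  by (induction I arbitrary: F) (simp_all add: sum_splits_Cons)

lemma sentences_iff: "I \<in> sentences A \<longleftrightarrow> [] \<notin> set I \<and> (\<forall>w\<in>set I. set w \<subseteq> A)"
  by (auto simp: sentences_def lists_eq_set)

lemma sentences_append [simp]: "I @ J \<in> sentences A \<longleftrightarrow> I \<in> sentences A \<and> J \<in> sentences A"
  by (auto simp: sentences_iff)

lemma Nil_in_sentences [simp]: "[] \<in> sentences A"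
  by (simp add: sentences_iff)

text \<open>Each letter of \<open>I\<close> goes to exactly one of the two parts, and
  \<open>strip\<close> removes only empty words. Non-empty words are assumed in \<open>I\<close>
  because the stripped parts could not detect an empty one.\<close>

lemma parts_in_sentences:
  assumes "uvs \<in> splits I" "[] \<notin> set I"
  shows "I \<in> sentences A \<longleftrightarrow> lpart uvs \<in> sentences A \<and> rpart uvs \<in> sentences A"
proof -
  have I: "I = map (\<lambda>(u, v). u @ v) uvs" using assms(1) by (simp add: splits_def)
  have "I \<in> sentences A \<longleftrightarrow> (\<forall>w\<in>set I. set w \<subseteq> A)" using assms(2) by (simp add: sentences_iff)
  also have "\<dots> \<longleftrightarrow> (\<forall>(u, v)\<in>set uvs. set u \<subseteq> A \<and> set v \<subseteq> A)"
    by (simp add: I case_prod_unfold)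
  finally have "I \<in> sentences A \<longleftrightarrow> (\<forall>(u, v)\<in>set uvs. set u \<subseteq> A \<and> set v \<subseteq> A)" .
  moreover have "lpart uvs \<in> sentences A \<longleftrightarrow> (\<forall>(u, v)\<in>set uvs. set u \<subseteq> A)"
    "rpart uvs \<in> sentences A \<longleftrightarrow> (\<forall>(u, v)\<in>set uvs. set v \<subseteq> A)"
    by (fastforce simp: sentences_iff strip_def)+
  ultimately show ?thesis by auto
qed

lemma sentence_size_simps [simp]:
  "sentence_size [] = 0" "sentence_size (w # I) = length w + sentence_size I"
  "sentence_size (I @ J) = sentence_size I + sentence_size J"
  "sentence_size (strip I) = sentence_size I"
proof -
  show "sentence_size (strip I) = sentence_size I"
    by (induction I) (auto simp: sentence_size_def strip_def)
qed (simp_all add: sentence_size_def)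

lemma sentence_size_parts:
  "uvs \<in> splits I \<Longrightarrow> sentence_size (lpart uvs) + sentence_size (rpart uvs) = sentence_size I"
  unfolding splits_def by (induction uvs arbitrary: I) auto

text \<open>Words of a sentence being non-empty, size at most \<open>n\<close> bounds both the
  number of words and their lengths by \<open>n\<close>. All later uses of the finite alphabet go
  back to this.\<close>

lemma finite_sentences_size:
  assumes "finite A"
  shows "finite {I \<in> sentences A. sentence_size I \<le> n}"
proof -
  let ?W = "{w. set w \<subseteq> A \<and> length w \<le> n}"
  have "length w \<le> sentence_size I" if "w \<in> set I" for w and I :: "'a list list"
    using that by (induction I) auto
  moreover have "length I \<le> sentence_size I" if "[] \<notin> set I" for I :: "'a list list"
    using that
  proof (induction I)
    case (Cons w I)
    then have "length w \<ge> 1" by (cases w) auto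
    moreover have "length I \<le> sentence_size I" using Cons by simp
    ultimately show ?case unfolding list.size sentence_size_simps by linarith
  qed simp
  ultimately have "{I \<in> sentences A. sentence_size I \<le> n} \<subseteq> {I. set I \<subseteq> ?W \<and> length I \<le> n}"
    by (fastforce simp: sentences_iff intro: order_trans)
  moreover have "finite {I. set I \<subseteq> ?W \<and> length I \<le> n}"
    by (intro finite_lists_length_le assms)
  ultimately show ?thesis by (rule finite_subset)
qed

section \<open>The operations of the graded dual, computed on values at sentences\<close>

definition conv :: "('a list list \<Rightarrow> 'k::field) \<Rightarrow> ('a list list \<Rightarrow> 'k) \<Rightarrow> 'a list list \<Rightarrow> 'k" where
  "conv f g I = (\<Sum>uvs\<in>splits I. f (lpart uvs) * g (rpart uvs))"

lemma supp_basis [simp]: "{y. basis x y \<noteq> (0::'k::field)} = {x}"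
  by (auto simp: basis_def)

lemma pairing_basis [simp]: "pairing \<phi> (basis x) = (\<phi> x :: 'k::field)"
  by (simp add: pairing_def) (simp add: basis_def)

text \<open>Different splittings can give the same pair of parts, so \<open>h\<close> may repeat
  values; equal basis elements then merge into one coefficient, which the exchange of sums
  distributes back over \<open>S\<close>.\<close>

lemma pairing_sum_basis:
  assumes "finite S"
  shows "pairing \<phi> (\<Sum>i\<in>S. basis (h i)) = (\<Sum>i\<in>S. \<phi> (h i) :: 'k::field)"
proof -
  let ?u = "\<Sum>i\<in>S. basis (h i) :: 'b \<Rightarrow> 'k"
  have u: "?u x = (\<Sum>i\<in>S. if x = h i then 1 else 0)" for x
    by (simp add: sum_fun_apply basis_def)
  have "?u x \<noteq> 0 \<Longrightarrow> x \<in> h ` S" for x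
    unfolding u by (rule ccontr) (auto intro!: sum.neutral simp: image_iff)
  then have "pairing \<phi> ?u = (\<Sum>x\<in>h ` S. \<phi> x * ?u x)"
    unfolding pairing_def using assms by (intro sum.mono_neutral_left) auto
  also have "\<dots> = (\<Sum>i\<in>S. \<Sum>x\<in>h ` S. if x = h i then \<phi> x else 0)"
    by (subst sum.swap) (simp add: u sum_distrib_left if_distrib cong: if_cong)
  also have "\<dots> = (\<Sum>i\<in>S. \<phi> (h i))"
    using assms by (intro sum.cong) auto
  finally show ?thesis .
qed

lemma tensor_basis: "basis x \<otimes> basis y = (basis (x, y) :: _ \<Rightarrow> 'k::field)"
  by (auto simp: tensor_def basis_def fun_eq_iff)

lemma scl_1 [simp]: "scl 1 f = f"
  by (simp add: scl_def)

lemma space_NSym_dual: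
  "space (NSym_dual A :: ('a list list, 'k::field) hopf_data) =
    {f. (\<forall>I. I \<notin> sentences A \<longrightarrow> f I = 0) \<and> (\<exists>n. \<forall>I\<in>sentences A. sentence_size I > n \<longrightarrow> f I = 0)}"
  by (simp add: NSym_dual_def graded_dual_def)

text \<open>Transposing the coproduct of NSym gives a convolution product: \<open>conv f g I\<close>
  is the value of \<open>f \<otimes> g\<close> at the coproduct of the basis element of
  \<open>I\<close>.\<close>

lemma mult_NSym_dual:
  "mult (NSym_dual A) f g I = (if I \<in> sentences A then conv f g I else (0::'k::field))"
proof -
  have "comult (NSym A) (basis I) = (\<Sum>uvs\<in>splits I. basis (lpart uvs, rpart uvs) :: _ \<Rightarrow> 'k)"
    by (simp add: NSym_def NSym_comult_basis_def splits_def tensor_basis) (simp add: basis_def)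
  then show ?thesis
    by (simp add: NSym_dual_def graded_dual_def pairing_sum_basis conv_def tensor_def)
qed

lemma unit_NSym_dual: "unit (NSym_dual A) = (basis [] :: _ \<Rightarrow> 'k::field)"
  by (auto simp: NSym_dual_def graded_dual_def NSym_def basis_def fun_eq_iff)

text \<open>The case distinction in \<open>graded_dual\<close> disappears because \<open>f\<close>
  vanishes off the sentences, and \<open>I @ J\<close> is a sentence exactly if \<open>I\<close> and
  \<open>J\<close> are.\<close>

lemma comult_NSym_dual:
  assumes "f \<in> space (NSym_dual A)"
  shows "comult (NSym_dual A) f (I, J) = (f (I @ J) :: 'k::field)"
proof -
  have "mult (NSym A) (basis I) (basis J) = (basis (I @ J) :: _ \<Rightarrow> 'k)"
    by (simp add: NSym_def) (simp add: basis_def)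
  then show ?thesis
    using assms by (auto simp: space_NSym_dual) (auto simp: NSym_dual_def graded_dual_def)
qed

lemma counit_NSym_dual: "counit (NSym_dual A) f = (f [] :: 'k::field)"
  by (simp add: NSym_dual_def graded_dual_def NSym_def)

lemma subspace_NSym_dual:
  "fun_space.subspace (space (NSym_dual A :: ('a list list, 'k::field) hopf_data))"
proof (rule fun_space.subspaceI)
  fix f g :: "'a list list \<Rightarrow> 'k"
  assume "f \<in> space (NSym_dual A)" "g \<in> space (NSym_dual A)"
  then obtain m n where "\<forall>I. I \<notin> sentences A \<longrightarrow> f I = 0" "\<forall>I\<in>sentences A. sentence_size I > m \<longrightarrow> f I = 0"
    "\<forall>I. I \<notin> sentences A \<longrightarrow> g I = 0" "\<forall>I\<in>sentences A. sentence_size I > n \<longrightarrow> g I = 0"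
    by (auto simp: space_NSym_dual)
  then have "\<forall>I\<in>sentences A. sentence_size I > max m n \<longrightarrow> (f + g) I = 0"
    "\<forall>I. I \<notin> sentences A \<longrightarrow> (f + g) I = 0" by simp_all
  then show "f + g \<in> space (NSym_dual A)" unfolding space_NSym_dual by blast
qed (auto simp: space_NSym_dual scl_def)

lemma basis_in_NSym_dual [simp]: "I \<in> sentences A \<Longrightarrow> basis I \<in> space (NSym_dual A)"
  by (auto simp: space_NSym_dual basis_def)

lemma mult_in_NSym_dual:
  fixes f g :: "'a list list \<Rightarrow> 'k::field"
  assumes "f \<in> space (NSym_dual A)" "g \<in> space (NSym_dual A)"
  shows "mult (NSym_dual A) f g \<in> space (NSym_dual A)"
proof -
  obtain m n where *: "\<forall>I. I \<notin> sentences A \<longrightarrow> f I = 0" "\<forall>I\<in>sentences A. sentence_size I > m \<longrightarrow> f I = 0"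
    "\<forall>I. I \<notin> sentences A \<longrightarrow> g I = 0" "\<forall>I\<in>sentences A. sentence_size I > n \<longrightarrow> g I = 0"
    using assms by (auto simp: space_NSym_dual)
  have "conv f g I = 0" if I: "sentence_size I > m + n" for I
    unfolding conv_def
  proof (intro sum.neutral ballI)
    fix uvs assume "uvs \<in> splits I"
    with I have "sentence_size (lpart uvs) > m \<or> sentence_size (rpart uvs) > n"
      using sentence_size_parts[of uvs I] by linarith
    with * show "f (lpart uvs) * g (rpart uvs) = 0" by (metis mult_eq_0_iff)
  qed
  then show ?thesis by (auto simp: space_NSym_dual mult_NSym_dual)
qed

text \<open>On sentences over \<open>A\<close> this is \<open>sum_factorizations\<close>. If the
  sentence of the monomial has a letter outside \<open>A\<close>, one part of each splitting
  contains that letter, so the convolution is zero, in agreement with the cut-off in the dual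
  product.\<close>

lemma pc_mult_word_seq:
  fixes f g :: "'a list list \<Rightarrow> 'k::field"
  assumes "f \<in> space (NSym_dual A)" "g \<in> space (NSym_dual A)"
  shows "pc_mult (f \<circ> word_seq) (g \<circ> word_seq) = mult (NSym_dual A) f g \<circ> word_seq"
proof
  fix m
  have "conv f g (word_seq m) = 0" if m: "word_seq m \<notin> sentences A"
    unfolding conv_def
  proof (intro sum.neutral ballI)
    fix uvs assume "uvs \<in> splits (word_seq m)"
    with m have "lpart uvs \<notin> sentences A \<or> rpart uvs \<notin> sentences A"
      using parts_in_sentences Nil_notin_word_seq by blast
    with assms show "f (lpart uvs) * g (rpart uvs) = 0" by (auto simp: space_NSym_dual)
  qed
  then show "pc_mult (f \<circ> word_seq) (g \<circ> word_seq) m = (mult (NSym_dual A) f g \<circ> word_seq) m"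
    using sum_factorizations[of "\<lambda>I J. f I * g J" m] by (auto simp: pc_mult_def mult_NSym_dual conv_def)
qed

text \<open>\<open>word_seq\<close> reaches every sentence, and elements of the dual vanish
  elsewhere.\<close>

lemma eq_if_pullback_eq:
  fixes f g :: "'a list list \<Rightarrow> 'k::field"
  assumes "f \<in> space (NSym_dual A)" "g \<in> space (NSym_dual A)"
    and eq: "f \<circ> word_seq = g \<circ> (word_seq :: ('a, nat) pcmon \<Rightarrow> _)"
  shows "f = g"
proof
  fix I
  show "f I = g I"
  proof (cases "I \<in> sentences A")
    case True
    then have "I \<in> range (word_seq :: ('a, nat) pcmon \<Rightarrow> _)"
      by (simp add: range_word_seq sentences_iff)
    then show ?thesis using fun_cong[OF eq] by auto
  qed (use assms in \<open>simp add: space_NSym_dual\<close>)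
qed

lemma lpart_eq_Nil_iff: "uvs \<in> splits I \<Longrightarrow> lpart uvs = [] \<longleftrightarrow> uvs = map (Pair []) I"
  unfolding splits_def by (induction uvs arbitrary: I) (auto simp: strip_def)

lemma rpart_eq_Nil_iff: "uvs \<in> splits I \<Longrightarrow> rpart uvs = [] \<longleftrightarrow> uvs = map (\<lambda>w. (w, [])) I"
  unfolding splits_def by (induction uvs arbitrary: I) (auto simp: strip_def)

lemma conv_unit:
  assumes "[] \<notin> set I"
  shows "conv (basis []) f I = f I" "conv f (basis []) I = f I"
proof -
  have s: "map (Pair []) I \<in> splits I" "map (\<lambda>w. (w, [])) I \<in> splits I"
    by (simp_all add: splits_def o_def)
  have "conv (basis []) f I = (\<Sum>uvs\<in>splits I. if uvs = map (Pair []) I then f I else 0)"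
    unfolding conv_def
    by (rule sum.cong) (auto simp: lpart_eq_Nil_iff basis_def o_def strip_id[OF assms])
  then show "conv (basis []) f I = f I" using s by simp
  have "conv f (basis []) I = (\<Sum>uvs\<in>splits I. if uvs = map (\<lambda>w. (w, [])) I then f I else 0)"
    unfolding conv_def
    by (rule sum.cong) (auto simp: rpart_eq_Nil_iff basis_def o_def strip_id[OF assms])
  then show "conv f (basis []) I = f I" using s by simp
qed

lemma is_algebra_NSym_dual: "is_algebra (NSym_dual A :: ('a list list, 'k::field) hopf_data)"
  unfolding is_algebra_def
proof (intro conjI ballI)
  let ?D = "NSym_dual A :: ('a list list, 'k) hopf_data"
  show "fun_space.subspace (space ?D)" by (rule subspace_NSym_dual)
  show "unit ?D \<in> space ?D" by (simp add: unit_NSym_dual)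
  fix f assume f: "f \<in> space ?D"
  show "linear_map_on (space ?D) (\<lambda>g. mult ?D f g)"
    by (auto simp: linear_map_on_def fun_eq_iff mult_NSym_dual conv_def scl_def algebra_simps
        sum.distrib sum_distrib_left)
  show "linear_map_on (space ?D) (\<lambda>g. mult ?D g f)"
    by (auto simp: linear_map_on_def fun_eq_iff mult_NSym_dual conv_def scl_def algebra_simps
        sum.distrib sum_distrib_left)
  have 0: "f I = 0" if "I \<notin> sentences A" for I using f that by (simp add: space_NSym_dual)
  show "mult ?D (unit ?D) f = f" "mult ?D f (unit ?D) = f"
    using 0 by (auto simp: fun_eq_iff mult_NSym_dual unit_NSym_dual conv_unit sentences_iff)
  fix g assume g: "g \<in> space ?D"
  show "mult ?D f g \<in> space ?D" using f g by (rule mult_in_NSym_dual)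
  fix h assume h: "h \<in> space ?D"
  \<comment> \<open>Associativity is inherited from series: pulling back is multiplicative and
    injective, so iterated splittings never have to be compared.\<close>
  show "mult ?D (mult ?D f g) h = mult ?D f (mult ?D g h)"
  proof (rule eq_if_pullback_eq[where A = A])
    show "mult ?D (mult ?D f g) h \<circ> word_seq =
        mult ?D f (mult ?D g h) \<circ> (word_seq :: ('a, nat) pcmon \<Rightarrow> _)"
      using f g h by (simp add: pc_mult_word_seq[symmetric] mult_in_NSym_dual pc_mult_assoc)
  qed (use f g h in \<open>simp_all add: mult_in_NSym_dual\<close>)
qed

lemma linear_map_on_comult_NSym_dual: "linear_map_on (space (NSym_dual A)) (comult (NSym_dual A))"
  unfolding linear_map_on_def
proof (intro conjI ballI allI ext, clarify)
  note sub = subspace_NSym_dual[of A]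
  fix f g :: "'a list list \<Rightarrow> 'b" and I J
  assume f: "f \<in> space (NSym_dual A)" and g: "g \<in> space (NSym_dual A)"
  show "comult (NSym_dual A) (f + g) (I, J) = (comult (NSym_dual A) f + comult (NSym_dual A) g) (I, J)"
    using fun_space.subspace_add[OF sub f g] f g by (simp add: comult_NSym_dual)
next
  note sub = subspace_NSym_dual[of A]
  fix f :: "'a list list \<Rightarrow> 'b" and c and IJ :: "'a list list \<times> 'a list list"
  assume f: "f \<in> space (NSym_dual A)"
  show "comult (NSym_dual A) (scl c f) IJ = scl c (comult (NSym_dual A) f) IJ"
    using fun_space.subspace_scale[OF sub f] f by (cases IJ) (simp add: comult_NSym_dual, simp add: scl_def comult_NSym_dual)
qed

text \<open>Expand in the second argument: \<open>f (I @ J)\<close> is the sum over \<open>K\<close>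
  of \<open>f (I @ K) * basis K J\<close>. Since \<open>f\<close> vanishes above some degree
  \<open>n\<close>, the finitely many sentences \<open>K\<close> of size at most \<open>n\<close>
  suffice.\<close>

lemma comult_NSym_dual_in_tensor_space:
  fixes f :: "'a list list \<Rightarrow> 'k::field"
  assumes "finite A" and f: "f \<in> space (NSym_dual A)"
  shows "comult (NSym_dual A) f \<in> tensor_space (space (NSym_dual A)) (space (NSym_dual A))"
proof -
  obtain n where 0: "\<And>I. I \<notin> sentences A \<Longrightarrow> f I = 0" and n: "\<And>I. sentence_size I > n \<Longrightarrow> f I = 0"
    using f by (auto simp: space_NSym_dual)
  let ?B = "{I \<in> sentences A. sentence_size I \<le> n}"
  obtain Ks where Ks: "set Ks = ?B" "distinct Ks"
    using finite_distinct_list[OF finite_sentences_size[OF assms(1)]] by blast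
  let ?ps = "map (\<lambda>K. (\<lambda>I. f (I @ K), basis K)) Ks :: (('a list list \<Rightarrow> 'k) \<times> ('a list list \<Rightarrow> 'k)) list"
  have "tensor_sum ?ps (I, J) = comult (NSym_dual A) f (I, J)" for I J
  proof -
    have "tensor_sum ?ps (I, J) = (\<Sum>K\<in>?B. f (I @ K) * basis K J)"
      using sum_list_distinct_conv_sum_set[OF Ks(2), of "\<lambda>K. f (I @ K) * basis K J"]
      by (simp add: tensor_sum_apply o_def Ks(1))
    also have "\<dots> = (\<Sum>K\<in>?B. if K = J then f (I @ K) else 0)"
      by (rule sum.cong) (auto simp: basis_def)
    also have "\<dots> = f (I @ J)"
    proof (cases "J \<in> ?B")
      case False
      then have "f (I @ J) = 0" using 0[of "I @ J"] n[of "I @ J"] by auto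
      with False show ?thesis by (auto simp: finite_sentences_size[OF assms(1)])
    qed (simp add: finite_sentences_size[OF assms(1)])
    finally show ?thesis using f by (simp add: comult_NSym_dual)
  qed
  then have "comult (NSym_dual A) f = tensor_sum ?ps" by (auto simp: fun_eq_iff)
  moreover have "(\<lambda>I. f (I @ K)) \<in> space (NSym_dual A)" for K
    using 0 n unfolding space_NSym_dual by (force intro: exI[of _ n])
  then have "set ?ps \<subseteq> space (NSym_dual A) \<times> space (NSym_dual A)" using Ks by auto
  ultimately show ?thesis unfolding tensor_space_def by blast
qed

text \<open>Decompositions in the axioms are arbitrary; the verifications of the counit, of
  coassociativity, of multiplicativity and of the antipode rest on these two facts about
  them.\<close>

lemma decomposes_NSym_dualD:
  assumes "decomposes (NSym_dual A) f ps" "f \<in> space (NSym_dual A)"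
  shows "\<And>v w. (v, w) \<in> set ps \<Longrightarrow> v \<in> space (NSym_dual A) \<and> w \<in> space (NSym_dual A)"
    and "\<And>I J. (\<Sum>(v, w)\<leftarrow>ps. v I * w J) = f (I @ J)"
  using assms comult_NSym_dual[OF assms(2)]
  by (auto simp: decomposes_def tensor_sum_apply[symmetric])

lemma is_coalgebra_NSym_dual:
  assumes "finite A"
  shows "is_coalgebra (NSym_dual A :: ('a list list, 'k::field) hopf_data)"
  unfolding is_coalgebra_def
proof (intro conjI ballI allI impI)
  let ?D = "NSym_dual A :: ('a list list, 'k) hopf_data"
  show "fun_space.subspace (space ?D)" by (rule subspace_NSym_dual)
  show "linear_map_on (space ?D) (comult ?D)" by (rule linear_map_on_comult_NSym_dual)
  show "linear_form_on (space ?D) (counit ?D)"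
    by (simp add: linear_form_on_def counit_NSym_dual scl_def)
  fix f assume f: "f \<in> space ?D"
  show "comult ?D f \<in> tensor_space (space ?D) (space ?D)"
    using assms f by (rule comult_NSym_dual_in_tensor_space)
  fix ps assume ps: "decomposes ?D f ps"
  note D = decomposes_NSym_dualD[OF ps f]
  show "(\<Sum>(v, w)\<leftarrow>ps. scl (counit ?D v) w) = f"
    using D(2)[of "[]"]
    by (auto simp: fun_eq_iff sum_list_fun_apply case_prod_unfold scl_def counit_NSym_dual)
  show "(\<Sum>(v, w)\<leftarrow>ps. scl (counit ?D w) v) = f"
    using D(2)[of _ "[]"]
    by (auto simp: fun_eq_iff sum_list_fun_apply case_prod_unfold scl_def counit_NSym_dual mult.commute)
  fix x y z
  have "(\<Sum>(v, w)\<leftarrow>ps. comult ?D v \<otimes> w) ((x, y), z) = (\<Sum>(v, w)\<leftarrow>ps. v (x @ y) * w z)"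
    unfolding sum_list_fun_apply
    by (intro arg_cong[where f = sum_list] map_cong) (auto simp: tensor_def comult_NSym_dual D(1))
  also have "\<dots> = (\<Sum>(v, w)\<leftarrow>ps. v x * w (y @ z))"
    by (simp add: D(2))
  also have "\<dots> = (\<Sum>(v, w)\<leftarrow>ps. v \<otimes> comult ?D w) (x, (y, z))"
    unfolding sum_list_fun_apply
    by (intro arg_cong[where f = sum_list] map_cong) (auto simp: tensor_def comult_NSym_dual D(1))
  finally show "(\<Sum>(v, w)\<leftarrow>ps. comult ?D v \<otimes> w) ((x, y), z) = (\<Sum>(v, w)\<leftarrow>ps. v \<otimes> comult ?D w) (x, (y, z))" .
qed

lemma is_bialgebra_NSym_dual:
  assumes "finite A"
  shows "is_bialgebra (NSym_dual A :: ('a list list, 'k::field) hopf_data)"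
  unfolding is_bialgebra_def
proof (intro conjI ballI allI impI)
  let ?D = "NSym_dual A :: ('a list list, 'k) hopf_data"
  show "is_algebra ?D" by (rule is_algebra_NSym_dual)
  show "is_coalgebra ?D" using assms by (rule is_coalgebra_NSym_dual)
  show "comult ?D (unit ?D) = unit ?D \<otimes> unit ?D"
    by (auto simp: fun_eq_iff unit_NSym_dual comult_NSym_dual tensor_basis) (auto simp: basis_def)
  show "counit ?D (unit ?D) = 1"
    by (simp add: counit_NSym_dual unit_NSym_dual basis_def)
  fix f g assume f: "f \<in> space ?D" and g: "g \<in> space ?D"
  show "counit ?D (mult ?D f g) = counit ?D f * counit ?D g"
    by (simp add: counit_NSym_dual mult_NSym_dual conv_def)
  fix ps qs assume ps: "decomposes ?D f ps" and qs: "decomposes ?D g qs"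
  note P = decomposes_NSym_dualD[OF ps f] and Q = decomposes_NSym_dualD[OF qs g]
  show "comult ?D (mult ?D f g) = (\<Sum>(v, w)\<leftarrow>ps. \<Sum>(v', w')\<leftarrow>qs. mult ?D v v' \<otimes> mult ?D w w')"
  proof (rule ext, clarify)
    fix x y
    have R: "(\<Sum>(v, w)\<leftarrow>ps. \<Sum>(v', w')\<leftarrow>qs. mult ?D v v' \<otimes> mult ?D w w') (x, y) =
        (\<Sum>(v, w)\<leftarrow>ps. \<Sum>(v', w')\<leftarrow>qs. mult ?D v v' x * mult ?D w w' y)"
      by (simp add: sum_list_fun_apply case_prod_unfold tensor_def)
    have L: "comult ?D (mult ?D f g) (x, y) = mult ?D f g (x @ y)"
      using f g by (simp add: comult_NSym_dual mult_in_NSym_dual)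
    show "comult ?D (mult ?D f g) (x, y) =
        (\<Sum>(v, w)\<leftarrow>ps. \<Sum>(v', w')\<leftarrow>qs. mult ?D v v' \<otimes> mult ?D w w') (x, y)"
    proof (cases "x \<in> sentences A \<and> y \<in> sentences A")
      case True
      then have "mult ?D f g (x @ y) =
          (\<Sum>a\<in>splits x. \<Sum>b\<in>splits y. f (lpart a @ lpart b) * g (rpart a @ rpart b))"
        by (simp add: mult_NSym_dual conv_def sum_splits_append)
      \<comment> \<open>Inserting the decompositions of both coproducts separates
        \<open>lpart a\<close> from \<open>lpart b\<close> and \<open>rpart a\<close> from
        \<open>rpart b\<close>; the factors then regroup into a convolution at \<open>x\<close> and
        a convolution at \<open>y\<close>.\<close>
      also have "\<dots> = (\<Sum>a\<in>splits x. \<Sum>b\<in>splits y. \<Sum>(v, w)\<leftarrow>ps. \<Sum>(v', w')\<leftarrow>qs.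
          (v (lpart a) * v' (rpart a)) * (w (lpart b) * w' (rpart b)))"
        unfolding P(2)[symmetric] Q(2)[symmetric] sum_list_mult_sum_list
        by (simp add: case_prod_unfold mult_ac)
      also have "\<dots> = (\<Sum>(v, w)\<leftarrow>ps. \<Sum>(v', w')\<leftarrow>qs. \<Sum>a\<in>splits x. \<Sum>b\<in>splits y.
          (v (lpart a) * v' (rpart a)) * (w (lpart b) * w' (rpart b)))"
        by (simp add: case_prod_unfold sum_list_sum_swap)
      also have "\<dots> = (\<Sum>(v, w)\<leftarrow>ps. \<Sum>(v', w')\<leftarrow>qs. mult ?D v v' x * mult ?D w w' y)"
        using True by (simp add: case_prod_unfold mult_NSym_dual conv_def sum_product)
      finally show ?thesis using L R by simp
    qed (unfold L R, auto simp: mult_NSym_dual case_prod_unfold)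
  qed
qed

section \<open>The antipode\<close>

definition comps :: "'a list \<Rightarrow> 'a list list set" where
  "comps w = {F. concat F = w \<and> [] \<notin> set F}"

lemma comps_Nil [simp]: "comps [] = {[]}"
  by (auto simp: comps_def) (metis list.set_intros(1) neq_Nil_conv)

lemma sentence_size_concat: "sentence_size F = length (concat F)"
  by (induction F) auto

lemma finite_comps [simp]: "finite (comps w)"
proof -
  have "comps w \<subseteq> {I \<in> sentences (set w). sentence_size I \<le> length w}"
    by (auto simp: comps_def sentences_iff sentence_size_concat)
  then show ?thesis by (rule finite_subset) (simp add: finite_sentences_size)
qed

abbreviation (input) sgn_len :: "'b list \<Rightarrow> 'k::field" where
  "sgn_len F \<equiv> (- 1) ^ length F"

text \<open>A factorization of a non-empty word is a factorization of a proper prefix followed by a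
  last word; removing \<open>(w, [])\<close> excludes precisely the empty last word.\<close>

lemma sum_comps_snoc:
  assumes "w \<noteq> []"
  shows "(\<Sum>F\<in>comps w. h F) = (\<Sum>(u, v)\<in>{(u, v). u @ v = w} - {(w, [])}. \<Sum>F\<in>comps u. h (F @ [v]))"
    (is "_ = sum _ ?P")
proof -
  have "(\<Sum>F\<in>comps w. h F) = (\<Sum>(p, F)\<in>Sigma ?P (\<lambda>(u, v). comps u). h (F @ [snd p]))"
  proof (rule sum.reindex_bij_witness[where i = "\<lambda>(p, F). F @ [snd p]"
        and j = "\<lambda>F. ((concat (butlast F), last F), butlast F)"])
    fix F assume "F \<in> comps w"
    with assms have "concat F = w" "[] \<notin> set F" "F \<noteq> []" by (auto simp: comps_def)
    then obtain F' v where "F = F' @ [v]" by (metis rev_exhaust)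
    with \<open>concat F = w\<close> \<open>[] \<notin> set F\<close>
    show "((concat (butlast F), last F), butlast F) \<in> Sigma ?P (\<lambda>(u, v). comps u)"
      "(\<lambda>(p, F). F @ [snd p]) ((concat (butlast F), last F), butlast F) = F"
      "(case ((concat (butlast F), last F), butlast F) of (p, F) \<Rightarrow> h (F @ [snd p])) = h F"
      by (auto simp: comps_def)
  qed (auto simp: comps_def)
  also have "\<dots> = (\<Sum>p\<in>?P. \<Sum>F\<in>comps (fst p). h (F @ [snd p]))"
    by (subst sum.Sigma[symmetric]) (auto simp: case_prod_unfold finite_append_eq[unfolded case_prod_unfold])
  finally show ?thesis by (simp add: case_prod_unfold)
qed

lemma sum_comps_Cons:
  assumes "w \<noteq> []"
  shows "(\<Sum>F\<in>comps w. h F) = (\<Sum>(u, v)\<in>{(u, v). u @ v = w} - {([], w)}. \<Sum>F\<in>comps v. h (u # F))"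
    (is "_ = sum _ ?P")
proof -
  have "(\<Sum>F\<in>comps w. h F) = (\<Sum>(p, F)\<in>Sigma ?P (\<lambda>(u, v). comps v). h (fst p # F))"
  proof (rule sum.reindex_bij_witness[where i = "\<lambda>(p, F). fst p # F"
        and j = "\<lambda>F. ((hd F, concat (tl F)), tl F)"])
    fix F assume "F \<in> comps w"
    with assms have "concat F = w" "[] \<notin> set F" "F \<noteq> []" by (auto simp: comps_def)
    then obtain F' v where "F = v # F'" by (metis list.exhaust)
    with \<open>concat F = w\<close> \<open>[] \<notin> set F\<close>
    show "((hd F, concat (tl F)), tl F) \<in> Sigma ?P (\<lambda>(u, v). comps v)"
      "(\<lambda>(p, F). fst p # F) ((hd F, concat (tl F)), tl F) = F"
      "(case ((hd F, concat (tl F)), tl F) of (p, F) \<Rightarrow> h (fst p # F)) = h F"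
      by (auto simp: comps_def)
  qed (auto simp: comps_def)
  also have "\<dots> = (\<Sum>p\<in>?P. \<Sum>F\<in>comps (snd p). h (fst p # F))"
    by (subst sum.Sigma[symmetric]) (auto simp: case_prod_unfold finite_append_eq[unfolded case_prod_unfold])
  finally show ?thesis by (simp add: case_prod_unfold)
qed

text \<open>The term with \<open>v = []\<close> is the signed sum over the factorizations of
  \<open>w\<close>. Splitting off the last word turns it into the remaining terms with opposite
  sign, the last word adding one to the length. This is one antipode identity for a single
  word.\<close>

lemma comps_cancel_right:
  fixes g :: "'a list list \<Rightarrow> 'k::field"
  assumes "w \<noteq> []"
  shows "(\<Sum>(u, v) | u @ v = w. \<Sum>F\<in>comps u. sgn_len F * g (F @ strip [v])) = 0"
proof -
  let ?P = "{(u, v). u @ v = w}"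
  have "(\<Sum>(u, v)\<in>?P. \<Sum>F\<in>comps u. sgn_len F * g (F @ strip [v])) =
      (\<Sum>F\<in>comps w. sgn_len F * g F) + (\<Sum>(u, v)\<in>?P - {(w, [])}. \<Sum>F\<in>comps u. sgn_len F * g (F @ strip [v]))"
    by (subst sum.remove[of _ "(w, [])"]) auto
  also have "(\<Sum>F\<in>comps w. sgn_len F * g F) =
      (\<Sum>(u, v)\<in>?P - {(w, [])}. \<Sum>F\<in>comps u. - (sgn_len F * g (F @ strip [v])))"
    unfolding sum_comps_snoc[OF assms]
  proof (rule sum.cong, goal_cases)
    case (2 p)
    then obtain u v where "p = (u, v)" "v \<noteq> []" by auto
    then show ?case by (simp add: sum_negf)
  qed simp
  finally show ?thesis by (simp add: case_prod_unfold sum_negf)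
qed

text \<open>Mirror image of \<open>comps_cancel_right\<close>, splitting off the first word; it is
  the other antipode identity for a single word.\<close>

lemma comps_cancel_left:
  fixes g :: "'a list list \<Rightarrow> 'k::field"
  assumes "w \<noteq> []"
  shows "(\<Sum>(u, v) | u @ v = w. \<Sum>F\<in>comps v. sgn_len F * g (strip [u] @ F)) = 0"
proof -
  let ?P = "{(u, v). u @ v = w}"
  have "(\<Sum>(u, v)\<in>?P. \<Sum>F\<in>comps v. sgn_len F * g (strip [u] @ F)) =
      (\<Sum>F\<in>comps w. sgn_len F * g F) + (\<Sum>(u, v)\<in>?P - {([], w)}. \<Sum>F\<in>comps v. sgn_len F * g (strip [u] @ F))"
    by (subst sum.remove[of _ "([], w)"]) auto
  also have "(\<Sum>F\<in>comps w. sgn_len F * g F) =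
      (\<Sum>(u, v)\<in>?P - {([], w)}. \<Sum>F\<in>comps v. - (sgn_len F * g (strip [u] @ F)))"
    unfolding sum_comps_Cons[OF assms]
  proof (rule sum.cong, goal_cases)
    case (2 p)
    then obtain u v where "p = (u, v)" "u \<noteq> []" by auto
    then show ?case by (simp add: sum_negf)
  qed simp
  finally show ?thesis by (simp add: case_prod_unfold sum_negf)
qed

text \<open>The value at \<open>S(H\<^sub>I)\<close> of the linear form on NSym which takes the values \<open>f J\<close> at \<open>H\<^sub>J\<close>.\<close>

primrec antipode_sum :: "'a list list \<Rightarrow> ('a list list \<Rightarrow> 'k::field) \<Rightarrow> 'k" where
  "antipode_sum [] f = f []"
| "antipode_sum (w # I) f = (\<Sum>F\<in>comps w. sgn_len F * antipode_sum I (\<lambda>J. f (J @ F)))"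

text \<open>The empty word has only the empty factorization, with sign 1, so empty words drop
  out.\<close>

lemma antipode_sum_strip [simp]: "antipode_sum (strip I) f = antipode_sum I f"
  by (induction I arbitrary: f) (simp_all add: strip_def)

lemma antipode_sum_add: "antipode_sum I (\<lambda>J. f J + g J) = antipode_sum I f + antipode_sum I g"
  by (induction I arbitrary: f g) (simp_all add: sum.distrib algebra_simps)

lemma antipode_sum_scale: "antipode_sum I (\<lambda>J. c * f J) = c * antipode_sum I f"
  by (induction I arbitrary: f) (simp_all add: sum_distrib_left algebra_simps)

lemma antipode_sum_0: "antipode_sum I (\<lambda>J. 0) = 0"
  by (induction I) simp_all

lemma antipode_sum_sum_list:
  "antipode_sum I (\<lambda>J. \<Sum>p\<leftarrow>ps. f p J) = (\<Sum>p\<leftarrow>ps. antipode_sum I (f p))"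
  by (induction ps) (simp_all add: antipode_sum_0 antipode_sum_add)

text \<open>Factoring words preserves the number of letters, so the antipode preserves degree; hence
  its transpose preserves vanishing in large degrees.\<close>

lemma antipode_sum_nonzeroD:
  "antipode_sum I f \<noteq> 0 \<Longrightarrow> \<exists>J. f J \<noteq> 0 \<and> sentence_size J = sentence_size I"
proof (induction I arbitrary: f)
  case (Cons w I)
  then obtain F where F: "F \<in> comps w" "antipode_sum I (\<lambda>J. f (J @ F)) \<noteq> 0"
    by (auto elim!: sum.not_neutral_contains_not_neutral)
  from Cons.IH[OF F(2)] obtain J where "f (J @ F) \<noteq> 0" "sentence_size J = sentence_size I" by blast
  moreover have "sentence_size F = length w" using F(1) by (simp add: sentence_size_concat comps_def)
  ultimately show ?case by (intro exI[of _ "J @ F"]) simp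
qed auto

text \<open>Reversing the order puts the factorization \<open>F\<close> of the prefix of the first
  word at the very end, next to the suffix \<open>strip [v]\<close> with which the right part
  begins. So the sum over the cuts of the first word cancels with all other cuts held fixed.\<close>

lemma antipode_sum_left:
  fixes f :: "'a list list \<Rightarrow> 'k::field"
  assumes "[] \<notin> set I"
  shows "(\<Sum>uvs\<in>splits I. antipode_sum (lpart uvs) (\<lambda>J. f (J @ rpart uvs))) = (if I = [] then f [] else 0)"
proof (cases I)
  case (Cons w I')
  with assms have w: "w \<noteq> []" by auto
  have "(\<Sum>uvs\<in>splits I. antipode_sum (lpart uvs) (\<lambda>J. f (J @ rpart uvs))) =
      (\<Sum>(u, v) | u @ v = w. \<Sum>uvs\<in>splits I'. \<Sum>F\<in>comps u.
        sgn_len F * antipode_sum (map fst uvs) (\<lambda>J. f (J @ (F @ strip [v]) @ rpart uvs)))"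
    by (simp add: Cons sum_splits_Cons strip_Cons[of _ "map snd _"])
  also have "\<dots> = (\<Sum>uvs\<in>splits I'. \<Sum>(u, v) | u @ v = w. \<Sum>F\<in>comps u.
        sgn_len F * antipode_sum (map fst uvs) (\<lambda>J. f (J @ (F @ strip [v]) @ rpart uvs)))"
    unfolding case_prod_unfold by (rule sum.swap)
  also have "\<dots> = 0"
    by (intro sum.neutral ballI comps_cancel_right[OF w])
  finally show ?thesis using Cons by simp
qed simp

text \<open>Here the prefix \<open>u\<close> of the first word stands in front and the factorization
  \<open>F\<close> of its suffix at the end, separated by the contribution of the other words. The
  induction hypothesis first collapses that contribution, to the empty sentence if there are no
  other words and to zero otherwise; then \<open>u\<close> and \<open>F\<close> are adjacent and
  \<open>comps_cancel_left\<close> applies.\<close>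

lemma antipode_sum_right:
  fixes f :: "'a list list \<Rightarrow> 'k::field"
  assumes "[] \<notin> set I"
  shows "(\<Sum>uvs\<in>splits I. antipode_sum (rpart uvs) (\<lambda>J. f (lpart uvs @ J))) = (if I = [] then f [] else 0)"
  using assms
proof (induction I arbitrary: f)
  case (Cons w I)
  then have w: "w \<noteq> []" by auto
  have IH: "(\<Sum>uvs\<in>splits I. antipode_sum (map snd uvs) (\<lambda>J. h (lpart uvs @ J))) = (if I = [] then h [] else 0)"
    for h :: "'a list list \<Rightarrow> 'k" using Cons by simp
  have IH': "(\<Sum>uvs\<in>splits I. antipode_sum (map snd uvs) (\<lambda>J. f (strip [u] @ (lpart uvs @ J) @ F))) =
      (if I = [] then f (strip [u] @ F) else 0)" for u F
    using IH[of "\<lambda>X. f (strip [u] @ X @ F)"] by simp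
  have "(\<Sum>uvs\<in>splits (w # I). antipode_sum (rpart uvs) (\<lambda>J. f (lpart uvs @ J))) =
      (\<Sum>(u, v) | u @ v = w. \<Sum>uvs\<in>splits I. \<Sum>F\<in>comps v.
        sgn_len F * antipode_sum (map snd uvs) (\<lambda>J. f (strip [u] @ (lpart uvs @ J) @ F)))"
    by (simp add: sum_splits_Cons strip_Cons[of _ "map fst _"])
  also have "\<dots> = (\<Sum>(u, v) | u @ v = w. \<Sum>F\<in>comps v. sgn_len F *
        (\<Sum>uvs\<in>splits I. antipode_sum (map snd uvs) (\<lambda>J. f (strip [u] @ (lpart uvs @ J) @ F))))"
    unfolding sum_distrib_left by (intro sum.cong refl) (auto intro: sum.swap)
  also have "\<dots> = (\<Sum>(u, v) | u @ v = w. \<Sum>F\<in>comps v. sgn_len F * (if I = [] then f (strip [u] @ F) else 0))"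
    by (simp only: IH')
  also have "\<dots> = 0"
    by (rule comps_cancel_left[OF w])
  finally show ?case by simp
qed simp

lemma antipode_NSym_dual:
  "is_antipode (NSym_dual A :: ('a list list, 'k::field) hopf_data)
    (\<lambda>f I. if I \<in> sentences A then antipode_sum I f else 0)" (is "is_antipode ?D ?S")
  unfolding is_antipode_def
proof (intro conjI ballI allI impI)
  show "linear_map_on (space ?D) ?S"
    by (auto simp: linear_map_on_def fun_eq_iff scl_def plus_fun_def antipode_sum_add antipode_sum_scale)
  fix f assume f: "f \<in> space ?D"
  then obtain n where 0: "\<And>I. I \<notin> sentences A \<Longrightarrow> f I = 0" and n: "\<And>I. sentence_size I > n \<Longrightarrow> f I = 0"
    by (auto simp: space_NSym_dual)
  have "antipode_sum I f = 0" if "sentence_size I > n" for I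
    using antipode_sum_nonzeroD[of I f] n that by metis
  then show "?S f \<in> space ?D" by (auto simp: space_NSym_dual)
  fix ps assume ps: "decomposes ?D f ps"
  note D = decomposes_NSym_dualD[OF ps f]
  have D': "(\<Sum>p\<leftarrow>ps. snd p J * fst p I) = f (I @ J)" "(\<Sum>p\<leftarrow>ps. fst p I * snd p J) = f (I @ J)" for I J
    using D(2)[where I = I and J = J] by (simp_all add: case_prod_unfold mult.commute)
  show "(\<Sum>(v, w)\<leftarrow>ps. mult ?D (?S v) w) = scl (counit ?D f) (unit ?D)"
  proof
    fix I
    show "(\<Sum>(v, w)\<leftarrow>ps. mult ?D (?S v) w) I = scl (counit ?D f) (unit ?D) I"
    proof (cases "I \<in> sentences A")
      case True
      then have I: "[] \<notin> set I" by (simp add: sentences_iff)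
      have "(\<Sum>(v, w)\<leftarrow>ps. mult ?D (?S v) w) I =
          (\<Sum>uvs\<in>splits I. \<Sum>p\<leftarrow>ps. snd p (rpart uvs) * antipode_sum (lpart uvs) (fst p))"
        using True parts_in_sentences[OF _ I, of _ A]
        by (simp add: sum_list_fun_apply case_prod_unfold mult_NSym_dual conv_def sum_list_sum_swap
            mult.commute cong: sum.cong)
      \<comment> \<open>By linearity of \<open>antipode_sum\<close> in the functional, the scalars
        and the sum over the decomposition move inside it, where they recombine to values of
        \<open>f\<close>.\<close>
      also have "\<dots> = (\<Sum>uvs\<in>splits I. antipode_sum (lpart uvs) (\<lambda>J. f (J @ rpart uvs)))"
        by (simp only: antipode_sum_scale[symmetric] antipode_sum_sum_list[symmetric] D')
      also have "\<dots> = scl (counit ?D f) (unit ?D) I"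
        unfolding antipode_sum_left[OF I] by (simp add: scl_def counit_NSym_dual unit_NSym_dual basis_def)
      finally show ?thesis .
    next
      case False
      then have "I \<noteq> []" by auto
      with False show ?thesis
        by (simp add: sum_list_fun_apply case_prod_unfold mult_NSym_dual scl_def unit_NSym_dual basis_def)
    qed
  qed
  show "(\<Sum>(v, w)\<leftarrow>ps. mult ?D v (?S w)) = scl (counit ?D f) (unit ?D)"
  proof
    fix I
    show "(\<Sum>(v, w)\<leftarrow>ps. mult ?D v (?S w)) I = scl (counit ?D f) (unit ?D) I"
    proof (cases "I \<in> sentences A")
      case True
      then have I: "[] \<notin> set I" by (simp add: sentences_iff)
      have "(\<Sum>(v, w)\<leftarrow>ps. mult ?D v (?S w)) I =
          (\<Sum>uvs\<in>splits I. \<Sum>p\<leftarrow>ps. fst p (lpart uvs) * antipode_sum (rpart uvs) (snd p))"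
        using True parts_in_sentences[OF _ I, of _ A]
        by (simp add: sum_list_fun_apply case_prod_unfold mult_NSym_dual conv_def sum_list_sum_swap
            cong: sum.cong)
      also have "\<dots> = (\<Sum>uvs\<in>splits I. antipode_sum (rpart uvs) (\<lambda>J. f (lpart uvs @ J)))"
        by (simp only: antipode_sum_scale[symmetric] antipode_sum_sum_list[symmetric] D')
      also have "\<dots> = scl (counit ?D f) (unit ?D) I"
        unfolding antipode_sum_right[OF I] by (simp add: scl_def counit_NSym_dual unit_NSym_dual basis_def)
      finally show ?thesis .
    next
      case False
      then have "I \<noteq> []" by auto
      with False show ?thesis
        by (simp add: sum_list_fun_apply case_prod_unfold mult_NSym_dual scl_def unit_NSym_dual basis_def)
    qed
  qed
qed

lemma is_hopf_algebra_NSym_dual: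
  "finite A \<Longrightarrow> is_hopf_algebra (NSym_dual A :: ('a list list, 'k::field) hopf_data)"
  unfolding is_hopf_algebra_def using is_bialgebra_NSym_dual antipode_NSym_dual by blast

section \<open>Coproducts of dual basis elements and uniqueness of the antipode\<close>

lemma sum_basis_tensor_basis:
  "(\<Sum>j = 0..length I. basis (take j I) \<otimes> basis (drop j I)) (x, y) = (basis I (x @ y) :: 'k::field)"
proof -
  have "(\<Sum>j = 0..length I. basis (take j I) \<otimes> basis (drop j I)) (x, y) =
      (\<Sum>j = 0..length I. if (take j I, drop j I) = (x, y) then 1 else 0 :: 'k)"
    unfolding sum_fun_apply tensor_basis by (rule sum.cong) (auto simp: basis_def)
  also have "\<dots> = (\<Sum>(u, v) | u @ v = I. if (u, v) = (x, y) then 1 else 0)"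
    by (rule sum_append_eq[symmetric])
  also have "\<dots> = (\<Sum>p | p \<in> {(u, v). u @ v = I}. if p = (x, y) then 1 else 0)"
    by (rule sum.cong) (simp_all add: case_prod_unfold prod_eq_iff)
  also have "\<dots> = basis I (x @ y)"
    using finite_append_eq[of I] by (simp add: basis_def)
  finally show ?thesis .
qed

lemma comult_basis_NSym_dual:
  assumes "I \<in> sentences A"
  shows "comult (NSym_dual A) (basis I) =
    (\<Sum>j = 0..length I. basis (take j I) \<otimes> basis (drop j I) :: _ \<Rightarrow> 'k::field)"
  using assms by (auto simp: fun_eq_iff sum_basis_tensor_basis comult_NSym_dual simp del: sum_fun_apply)

lemma take_drop_sentences:
  "I \<in> sentences A \<Longrightarrow> take j I \<in> sentences A \<and> drop j I \<in> sentences A"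
  by (metis append_take_drop_id sentences_append)

lemma decomposes_basis:
  assumes "I \<in> sentences A"
  shows "decomposes (NSym_dual A :: ('a list list, 'k::field) hopf_data) (basis I)
    (map (\<lambda>j. (basis (take j I), basis (drop j I))) [0..<Suc (length I)])"
  using take_drop_sentences[OF assms]
  by (auto simp: decomposes_def tensor_sum_def comult_basis_NSym_dual[OF assms] o_def
      interv_sum_list_conv_sum_set_nat atLeastLessThanSuc_atLeastAtMost simp del: upt_Suc)

lemma linear_map_on_sum:
  assumes "linear_map_on V F" "fun_space.subspace V" "\<And>i. i \<in> S \<Longrightarrow> g i \<in> V"
  shows "F (\<Sum>i\<in>S. scl (c i) (g i)) = (\<Sum>i\<in>S. scl (c i) (F (g i)))"
proof -
  have 0: "F 0 = 0"
    using assms(1) fun_space.subspace_0[OF assms(2)]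
    unfolding linear_map_on_def by (metis fun_space.scale_zero_left)
  show ?thesis
    using assms(3)
  proof (induction S rule: infinite_finite_induct)
    case (insert i S)
    have "scl (c i) (g i) \<in> V" "(\<Sum>i\<in>S. scl (c i) (g i)) \<in> V"
      using insert.prems assms(2) by (auto intro!: fun_space.subspace_scale fun_space.subspace_sum)
    then have "F (scl (c i) (g i) + (\<Sum>i\<in>S. scl (c i) (g i))) =
        F (scl (c i) (g i)) + F (\<Sum>i\<in>S. scl (c i) (g i))"
      using assms(1) unfolding linear_map_on_def by blast
    moreover have "F (scl (c i) (g i)) = scl (c i) (F (g i))"
      using assms(1) insert.prems unfolding linear_map_on_def by blast
    ultimately show ?case
      using insert.IH insert.prems by (simp only: sum.insert[OF insert.hyps] insertI2)
  qed (simp_all add: 0)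
qed

text \<open>Vanishing in large degrees leaves only finitely many sentences over the finite alphabet,
  so the dual basis spans the graded dual.\<close>

lemma NSym_dual_expansion:
  fixes f :: "'a list list \<Rightarrow> 'k::field"
  assumes "finite A" "f \<in> space (NSym_dual A)"
  shows "finite {I. f I \<noteq> 0}" "{I. f I \<noteq> 0} \<subseteq> sentences A"
    and "f = (\<Sum>I | f I \<noteq> 0. scl (f I) (basis I))"
proof -
  obtain n where n: "\<And>I. I \<notin> sentences A \<Longrightarrow> f I = 0" "\<And>I. sentence_size I > n \<Longrightarrow> f I = 0"
    using assms(2) by (auto simp: space_NSym_dual)
  then have "{I. f I \<noteq> 0} \<subseteq> {I \<in> sentences A. sentence_size I \<le> n}" by force
  then show fin: "finite {I. f I \<noteq> 0}" and "{I. f I \<noteq> 0} \<subseteq> sentences A"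
    using finite_sentences_size[OF assms(1)] by (auto intro: finite_subset)
  show "f = (\<Sum>I | f I \<noteq> 0. scl (f I) (basis I))"
  proof
    fix J
    have "(\<Sum>I | f I \<noteq> 0. scl (f I) (basis I)) J = (\<Sum>I | f I \<noteq> 0. if I = J then f J else 0)"
      unfolding sum_fun_apply by (rule sum.cong) (auto simp: scl_def basis_def)
    then show "f J = (\<Sum>I | f I \<noteq> 0. scl (f I) (basis I)) J" using fin by simp
  qed
qed

lemma sum_basis_in_NSym_dual:
  "S \<subseteq> sentences A \<Longrightarrow> (\<Sum>I\<in>S. scl (c I) (basis I)) \<in> space (NSym_dual A)"
  by (intro fun_space.subspace_sum fun_space.subspace_scale subspace_NSym_dual basis_in_NSym_dual) auto

text \<open>The antipode identity at \<open>basis I\<close> is a recursion on the number of words: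
  the cut \<open>j = length I\<close> contributes the value at \<open>basis I\<close> times the
  unit, and every other cut involves a shorter prefix.\<close>

lemma antipode_basis_eq:
  fixes S T :: "('a list list \<Rightarrow> 'k::field) \<Rightarrow> 'a list list \<Rightarrow> 'k"
  assumes S: "is_antipode (NSym_dual A) S" and T: "is_antipode (NSym_dual A) T"
  shows "I \<in> sentences A \<Longrightarrow> S (basis I) = T (basis I)"
proof (induction "length I" arbitrary: I rule: less_induct)
  case less
  let ?D = "NSym_dual A :: ('a list list, 'k) hopf_data"
  have rec: "R (basis I) = scl (counit ?D (basis I)) (unit ?D) -
      (\<Sum>j\<leftarrow>[0..<length I]. mult ?D (R (basis (take j I))) (basis (drop j I)))"
    if R: "is_antipode ?D R" for R
  proof -
    have "mult ?D (R (basis I)) (basis []) = R (basis I)"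
    proof -
      have "R (basis I) \<in> space ?D"
        using R basis_in_NSym_dual[OF less.prems] unfolding is_antipode_def by blast
      then show ?thesis
        using is_algebra_NSym_dual[of A] unfolding is_algebra_def unit_NSym_dual by blast
    qed
    moreover have "(\<Sum>(v, w)\<leftarrow>map (\<lambda>j. (basis (take j I), basis (drop j I))) [0..<Suc (length I)]. mult ?D (R v) w)
        = scl (counit ?D (basis I)) (unit ?D)"
      using R decomposes_basis[OF less.prems] basis_in_NSym_dual[OF less.prems]
      unfolding is_antipode_def by blast
    ultimately show ?thesis by (simp add: o_def algebra_simps)
  qed
  have "S (basis (take j I)) = T (basis (take j I))" if "j < length I" for j
    using that less.prems by (intro less.hyps) (auto simp: take_drop_sentences)
  then have "map (\<lambda>j. mult ?D (S (basis (take j I))) (basis (drop j I))) [0..<length I] =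
      map (\<lambda>j. mult ?D (T (basis (take j I))) (basis (drop j I))) [0..<length I]" by simp
  then show ?case unfolding rec[OF S] rec[OF T] by argo
qed

lemma antipode_NSym_dual_unique:
  fixes S T :: "('a list list \<Rightarrow> 'k::field) \<Rightarrow> 'a list list \<Rightarrow> 'k"
  assumes "finite A" and S: "is_antipode (NSym_dual A) S" and T: "is_antipode (NSym_dual A) T"
    and f: "f \<in> space (NSym_dual A)"
  shows "S f = T f"
proof -
  note e = NSym_dual_expansion[OF assms(1) f]
  have b: "basis I \<in> space (NSym_dual A)" if "I \<in> {I. f I \<noteq> 0}" for I
    using that e(2) by auto
  have R: "R f = (\<Sum>I | f I \<noteq> 0. scl (f I) (R (basis I)))" if "is_antipode (NSym_dual A) R" for R
  proof -
    have lin: "linear_map_on (space (NSym_dual A)) R" using that by (simp add: is_antipode_def)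
    have "R f = R (\<Sum>I | f I \<noteq> 0. scl (f I) (basis I))" by (rule arg_cong[OF e(3)])
    also have "\<dots> = (\<Sum>I | f I \<noteq> 0. scl (f I) (R (basis I)))"
      by (rule linear_map_on_sum[OF lin subspace_NSym_dual b])
    finally show ?thesis .
  qed
  show ?thesis
    unfolding R[OF S] R[OF T] using antipode_basis_eq[OF S T] e(2) by (intro sum.cong) auto
qed

section \<open>Transport of Hopf structures along a map of index sets\<close>

text \<open>The map \<open>\<pi>\<close> may identify many points; vanishing off its range makes
  \<open>u\<close> recoverable from \<open>u \<circ> \<pi>\<close>. Tensors are functions on pairs,
  so they are pulled back along \<open>map_prod \<pi> \<pi>\<close>.\<close>

locale hopf_pullback =
  fixes H :: "('x, 'k::field) hopf_data" and K :: "('y, 'k) hopf_data" and \<pi> :: "'x \<Rightarrow> 'y"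
  assumes space_H: "space H = (\<lambda>u. u \<circ> \<pi>) ` space K"
    and off_range: "u \<in> space K \<Longrightarrow> y \<notin> range \<pi> \<Longrightarrow> u y = 0"
    and mult_H: "u \<in> space K \<Longrightarrow> v \<in> space K \<Longrightarrow> mult H (u \<circ> \<pi>) (v \<circ> \<pi>) = mult K u v \<circ> \<pi>"
    and unit_H: "unit H = unit K \<circ> \<pi>"
    and comult_H: "u \<in> space K \<Longrightarrow> comult H (u \<circ> \<pi>) = comult K u \<circ> map_prod \<pi> \<pi>"
    and counit_H: "u \<in> space K \<Longrightarrow> counit H (u \<circ> \<pi>) = counit K u"
    and hopf_K: "is_hopf_algebra K"
begin

abbreviation pull :: "('y \<Rightarrow> 'k) \<Rightarrow> 'x \<Rightarrow> 'k" where
  "pull u \<equiv> u \<circ> \<pi>"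

text \<open>This inverts \<open>pull\<close> on the space of \<open>K\<close>: for functions
  constant on the fibres of \<open>\<pi>\<close>, the preimage chosen by \<open>inv\<close> does not
  matter.\<close>

definition push :: "('x \<Rightarrow> 'k) \<Rightarrow> 'y \<Rightarrow> 'k" where
  "push f = (\<lambda>y. if y \<in> range \<pi> then f (inv \<pi> y) else 0)"

abbreviation pull_list :: "(('y \<Rightarrow> 'k) \<times> ('y \<Rightarrow> 'k)) list \<Rightarrow> (('x \<Rightarrow> 'k) \<times> ('x \<Rightarrow> 'k)) list" where
  "pull_list \<equiv> map (map_prod pull pull)"

lemma push_pull [simp]: "u \<in> space K \<Longrightarrow> push (pull u) = u"
  by (auto simp: push_def fun_eq_iff off_range f_inv_into_f)

lemma pull_inject: "u \<in> space K \<Longrightarrow> v \<in> space K \<Longrightarrow> pull u = pull v \<longleftrightarrow> u = v"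
  by (metis push_pull)

lemma pull_add: "pull u + pull v = pull (u + v)"
  by auto

lemma pull_scl: "scl c (pull u) = pull (scl c u)"
  by (auto simp: scl_def)

lemma pull_0: "0 = pull 0"
  by auto

lemma pull_sum_list: "(\<Sum>p\<leftarrow>ps. pull (f p)) = pull (\<Sum>p\<leftarrow>ps. f p)"
  by (induction ps) (simp_all add: pull_add flip: pull_0)

lemma
  subspace_K: "fun_space.subspace (space K)" and
  unit_K: "unit K \<in> space K" and
  mult_closed_K: "u \<in> space K \<Longrightarrow> v \<in> space K \<Longrightarrow> mult K u v \<in> space K"
  using hopf_K by (auto simp: is_hopf_algebra_def is_bialgebra_def is_algebra_def)

lemma add_closed_K: "u \<in> space K \<Longrightarrow> v \<in> space K \<Longrightarrow> u + v \<in> space K"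
  by (rule fun_space.subspace_add[OF subspace_K])

lemma scl_closed_K: "u \<in> space K \<Longrightarrow> scl c u \<in> space K"
  by (rule fun_space.subspace_scale[OF subspace_K])

lemmas closed_K = unit_K mult_closed_K add_closed_K scl_closed_K

lemma comult_K_tensor:
  assumes "u \<in> space K"
  obtains qs where "decomposes K u qs"
proof -
  have "comult K u \<in> tensor_space (space K) (space K)"
    using hopf_K assms by (auto simp: is_hopf_algebra_def is_bialgebra_def is_coalgebra_def)
  then show ?thesis using that by (auto simp: tensor_space_def decomposes_def)
qed

lemma tensor_sum_off_range:
  assumes "set qs \<subseteq> space K \<times> space K" "y \<notin> range \<pi> \<or> y' \<notin> range \<pi>"
  shows "tensor_sum qs (y, y') = 0"
proof -
  have "map (\<lambda>(v, w). v y * w y') qs = map (\<lambda>_. 0) qs" using assms off_range by fastforce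
  then show ?thesis unfolding tensor_sum_apply by (simp only: sum_list_0)
qed

lemma tensor_sum_pull_list: "tensor_sum (pull_list qs) = tensor_sum qs \<circ> map_prod \<pi> \<pi>"
  by (auto simp: fun_eq_iff tensor_sum_apply case_prod_unfold o_def)

text \<open>\<open>pull\<close> being bijective between the spaces, every decomposition over
  \<open>H\<close> comes from one over \<open>K\<close>; so an axiom about arbitrary decompositions
  over \<open>H\<close> reduces to the same axiom for \<open>K\<close>.\<close>

lemma decomposes_pull_list:
  assumes u: "u \<in> space K" and ps: "decomposes H (pull u) ps"
  obtains qs where "ps = pull_list qs" "decomposes K u qs" "set qs \<subseteq> space K \<times> space K"
proof
  let ?qs = "map (map_prod push push) ps"
  have s: "set ps \<subseteq> pull ` space K \<times> pull ` space K" using ps by (simp add: decomposes_def space_H)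
  then show qs: "set ?qs \<subseteq> space K \<times> space K" by force
  have "map_prod pull pull (map_prod push push p) = p" if "p \<in> set ps" for p
  proof -
    have "p \<in> pull ` space K \<times> pull ` space K" using that s by blast
    then show ?thesis by auto
  qed
  then show eq: "ps = pull_list ?qs" by (simp add: map_idI)
  \<comment> \<open>An auxiliary decomposition, used to see that \<open>comult K u\<close> vanishes
    when a coordinate is off the range, where the pullback gives no information.\<close>
  obtain rs where rs: "decomposes K u rs" using comult_K_tensor[OF u] .
  have *: "comult K u \<circ> map_prod \<pi> \<pi> = tensor_sum ?qs \<circ> map_prod \<pi> \<pi>"
    using ps comult_H[OF u] eq tensor_sum_pull_list[of ?qs] by (metis decomposes_def)
  have "comult K u (y, y') = tensor_sum ?qs (y, y')" for y y'
  proof (cases "y \<in> range \<pi> \<and> y' \<in> range \<pi>")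
    case True
    then obtain x x' where "y = \<pi> x" "y' = \<pi> x'" by blast
    then show ?thesis using fun_cong[OF *, of "(x, x')"] by simp
  next
    case False
    then show ?thesis
      using rs tensor_sum_off_range[OF qs] tensor_sum_off_range[of rs] by (auto simp: decomposes_def)
  qed
  then show "decomposes K u ?qs" using qs by (auto simp: decomposes_def)
qed

lemma pull_tensor: "pull v \<otimes> pull w = (v \<otimes> w) \<circ> map_prod \<pi> \<pi>"
  by (auto simp: tensor_def fun_eq_iff)

lemma is_algebra_H: "is_algebra H"
proof -
  have K: "is_algebra K" using hopf_K by (auto simp: is_hopf_algebra_def is_bialgebra_def)
  have "fun_space.subspace (space H)"
    unfolding space_H
  proof (rule fun_space.subspaceI)
    show "0 \<in> pull ` space K" by (rule image_eqI[where f = pull and x = 0, OF pull_0 fun_space.subspace_0[OF subspace_K]])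
  qed (auto simp: pull_add pull_scl intro!: imageI closed_K)
  then show ?thesis
    using K unfolding is_algebra_def linear_map_on_def space_H
    by (simp add: pull_add pull_scl unit_H mult_H closed_K)
qed

lemma is_coalgebra_H: "is_coalgebra H"
  unfolding is_coalgebra_def
proof (intro conjI ballI allI impI)
  have K: "is_coalgebra K" using hopf_K by (auto simp: is_hopf_algebra_def is_bialgebra_def)
  show "fun_space.subspace (space H)" using is_algebra_H by (simp add: is_algebra_def)
  show "linear_map_on (space H) (comult H)"
    using K unfolding is_coalgebra_def linear_map_on_def space_H
    by (auto simp: pull_add pull_scl comult_H closed_K) (auto simp: scl_def fun_eq_iff)
  show "linear_form_on (space H) (counit H)"
    using K unfolding is_coalgebra_def linear_form_on_def space_H
    by (auto simp: pull_add pull_scl counit_H closed_K)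
  fix f assume "f \<in> space H"
  then obtain u where u: "f = pull u" "u \<in> space K" by (auto simp: space_H)
  obtain rs where rs: "decomposes K u rs" using comult_K_tensor[OF u(2)] .
  then have "comult H f = tensor_sum (pull_list rs)" "set (pull_list rs) \<subseteq> space H \<times> space H"
    by (auto simp: u comult_H tensor_sum_pull_list space_H decomposes_def)
  then show "comult H f \<in> tensor_space (space H) (space H)" unfolding tensor_space_def by blast
  fix ps assume "decomposes H f ps"
  then obtain qs where qs: "ps = pull_list qs" "decomposes K u qs" "set qs \<subseteq> space K \<times> space K"
    using decomposes_pull_list u by blast
  have c: "(\<Sum>(v, w)\<leftarrow>qs. scl (counit K v) w) = u" "(\<Sum>(v, w)\<leftarrow>qs. scl (counit K w) v) = u"
    "\<And>x y z. (\<Sum>(v, w)\<leftarrow>qs. comult K v \<otimes> w) ((x, y), z) = (\<Sum>(v, w)\<leftarrow>qs. v \<otimes> comult K w) (x, (y, z))"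
    using K u(2) qs(2) unfolding is_coalgebra_def by blast+
  have "(\<Sum>(v, w)\<leftarrow>ps. scl (counit H v) w) = (\<Sum>(v, w)\<leftarrow>qs. pull (scl (counit K v) w))"
    unfolding qs(1) using qs(3)
    by (simp add: o_def[of _ "map_prod _ _"], intro arg_cong[where f = sum_list] map_cong)
      (auto simp: counit_H pull_scl)
  then show "(\<Sum>(v, w)\<leftarrow>ps. scl (counit H v) w) = f"
    using c(1) by (simp add: u case_prod_unfold pull_sum_list)
  have "(\<Sum>(v, w)\<leftarrow>ps. scl (counit H w) v) = (\<Sum>(v, w)\<leftarrow>qs. pull (scl (counit K w) v))"
    unfolding qs(1) using qs(3)
    by (simp add: o_def[of _ "map_prod _ _"], intro arg_cong[where f = sum_list] map_cong)
      (auto simp: counit_H pull_scl)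
  then show "(\<Sum>(v, w)\<leftarrow>ps. scl (counit H w) v) = f"
    using c(2) by (simp add: u case_prod_unfold pull_sum_list)
  fix x y z
  have "(\<Sum>(v, w)\<leftarrow>ps. comult H v \<otimes> w) ((x, y), z) = (\<Sum>(v, w)\<leftarrow>qs. comult K v \<otimes> w) ((\<pi> x, \<pi> y), \<pi> z)"
    unfolding qs(1) sum_list_fun_apply using qs(3)
    by (simp add: o_def[of _ "map_prod _ _"], intro arg_cong[where f = sum_list] map_cong)
      (auto simp: comult_H tensor_def)
  moreover have "(\<Sum>(v, w)\<leftarrow>ps. v \<otimes> comult H w) (x, (y, z)) = (\<Sum>(v, w)\<leftarrow>qs. v \<otimes> comult K w) (\<pi> x, (\<pi> y, \<pi> z))"
    unfolding qs(1) sum_list_fun_apply using qs(3)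
    by (simp add: o_def[of _ "map_prod _ _"], intro arg_cong[where f = sum_list] map_cong)
      (auto simp: comult_H tensor_def)
  ultimately show "(\<Sum>(v, w)\<leftarrow>ps. comult H v \<otimes> w) ((x, y), z) = (\<Sum>(v, w)\<leftarrow>ps. v \<otimes> comult H w) (x, (y, z))"
    using c(3) by simp
qed

lemma is_bialgebra_H: "is_bialgebra H"
  unfolding is_bialgebra_def
proof (intro conjI ballI allI impI)
  have K: "is_bialgebra K" using hopf_K by (simp add: is_hopf_algebra_def)
  show "is_algebra H" "is_coalgebra H" by (rule is_algebra_H, rule is_coalgebra_H)
  show "comult H (unit H) = unit H \<otimes> unit H" "counit H (unit H) = 1"
    using K by (simp_all add: is_bialgebra_def unit_H comult_H counit_H pull_tensor closed_K)
  fix f g assume "f \<in> space H" "g \<in> space H"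
  then obtain u u' where u: "f = pull u" "u \<in> space K" and u': "g = pull u'" "u' \<in> space K"
    by (auto simp: space_H)
  show "counit H (mult H f g) = counit H f * counit H g"
    using K u u' by (simp add: is_bialgebra_def mult_H counit_H closed_K)
  fix ps ps' assume "decomposes H f ps" "decomposes H g ps'"
  then obtain qs qs' where qs: "ps = pull_list qs" "decomposes K u qs" "set qs \<subseteq> space K \<times> space K"
    and qs': "ps' = pull_list qs'" "decomposes K u' qs'" "set qs' \<subseteq> space K \<times> space K"
    using decomposes_pull_list u u' by metis
  have mem: "fst p \<in> space K" "snd p \<in> space K" if "p \<in> set qs \<or> p \<in> set qs'" for p
    using that qs(3) qs'(3) by auto
  have "comult K (mult K u u') = (\<Sum>(v, w)\<leftarrow>qs. \<Sum>(v', w')\<leftarrow>qs'. mult K v v' \<otimes> mult K w w')"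
    using K u(2) u'(2) qs(2) qs'(2) unfolding is_bialgebra_def by blast
  then have "comult H (mult H f g) (x, y) =
      (\<Sum>(v, w)\<leftarrow>qs. \<Sum>(v', w')\<leftarrow>qs'. (mult K v v' \<otimes> mult K w w') (\<pi> x, \<pi> y))" for x y
    using u u' by (simp add: mult_H comult_H closed_K sum_list_fun_apply case_prod_unfold)
  also have "\<dots> x y = (\<Sum>(v, w)\<leftarrow>ps. \<Sum>(v', w')\<leftarrow>ps'. (mult H v v' \<otimes> mult H w w') (x, y))" for x y
    unfolding qs(1) qs'(1) map_map o_def[of _ "map_prod pull pull"] case_prod_unfold fst_map_prod snd_map_prod
    by (intro arg_cong[where f = sum_list] map_cong refl) (simp_all add: mem tensor_def mult_H)
  finally show "comult H (mult H f g) = (\<Sum>(v, w)\<leftarrow>ps. \<Sum>(v', w')\<leftarrow>ps'. mult H v v' \<otimes> mult H w w')"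
    by (auto simp: fun_eq_iff sum_list_fun_apply case_prod_unfold)
qed

lemma antipode_pull:
  assumes S: "is_antipode K S"
  shows "is_antipode H (\<lambda>f. pull (S (push f)))"
  unfolding is_antipode_def
proof (intro conjI ballI allI impI)
  show "linear_map_on (space H) (\<lambda>f. pull (S (push f)))"
    using S unfolding is_antipode_def linear_map_on_def space_H
    by (auto simp: pull_add pull_scl closed_K)
  fix f assume "f \<in> space H"
  then obtain u where u: "f = pull u" "u \<in> space K" by (auto simp: space_H)
  then show "pull (S (push f)) \<in> space H" using S by (simp add: is_antipode_def space_H)
  fix ps assume "decomposes H f ps"
  then obtain qs where qs: "ps = pull_list qs" "decomposes K u qs" "set qs \<subseteq> space K \<times> space K"
    using decomposes_pull_list u by blast
  have Sc: "S v \<in> space K" if "v \<in> space K" for v using S that by (simp add: is_antipode_def)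
  have S': "(\<Sum>(v, w)\<leftarrow>qs. mult K (S v) w) = scl (counit K u) (unit K)"
    "(\<Sum>(v, w)\<leftarrow>qs. mult K v (S w)) = scl (counit K u) (unit K)"
    using S u(2) qs(2) unfolding is_antipode_def by blast+
  have "(\<Sum>(v, w)\<leftarrow>ps. mult H (pull (S (push v))) w) = (\<Sum>(v, w)\<leftarrow>qs. pull (mult K (S v) w))"
    unfolding qs(1) using qs(3)
    by (simp add: o_def[of _ "map_prod _ _"], intro arg_cong[where f = sum_list] map_cong)
      (auto simp: mult_H Sc)
  then show "(\<Sum>(v, w)\<leftarrow>ps. mult H (pull (S (push v))) w) = scl (counit H f) (unit H)"
    using S'(1) u by (simp add: case_prod_unfold pull_sum_list counit_H unit_H pull_scl)
  have "(\<Sum>(v, w)\<leftarrow>ps. mult H v (pull (S (push w)))) = (\<Sum>(v, w)\<leftarrow>qs. pull (mult K v (S w)))"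
    unfolding qs(1) using qs(3)
    by (simp add: o_def[of _ "map_prod _ _"], intro arg_cong[where f = sum_list] map_cong)
      (auto simp: mult_H Sc)
  then show "(\<Sum>(v, w)\<leftarrow>ps. mult H v (pull (S (push w)))) = scl (counit H f) (unit H)"
    using S'(2) u by (simp add: case_prod_unfold pull_sum_list counit_H unit_H pull_scl)
qed

text \<open>Transport in this direction lets an arbitrary antipode of \<open>H\<close> be compared
  with one of \<open>K\<close>, where uniqueness is known; that yields the antipode clause of
  \<open>hopf_iso\<close>.\<close>

lemma antipode_push:
  assumes S: "is_antipode H S"
  shows "is_antipode K (\<lambda>u. push (S (pull u)))"
  unfolding is_antipode_def
proof (intro conjI ballI allI impI)
  have SH: "S f \<in> space H" if "f \<in> space H" for f using S that by (simp add: is_antipode_def)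
  have Sc: "push (S (pull u)) \<in> space K" "pull (push (S (pull u))) = S (pull u)" if "u \<in> space K" for u
    using SH[of "pull u"] that by (auto simp: space_H)
  show "linear_map_on (space K) (\<lambda>u. push (S (pull u)))"
    unfolding linear_map_on_def
  proof (intro conjI ballI allI)
    have lin: "linear_map_on (pull ` space K) S" using S by (simp add: is_antipode_def space_H)
    fix u v assume u: "u \<in> space K" and v: "v \<in> space K"
    have "S (pull u + pull v) = S (pull u) + S (pull v)"
      using lin u v unfolding linear_map_on_def by blast
    also have "\<dots> = pull (push (S (pull u)) + push (S (pull v)))"
      using u v by (simp only: pull_add[symmetric] Sc)
    finally show "push (S (pull (u + v))) = push (S (pull u)) + push (S (pull v))"
      using u v by (simp only: pull_add push_pull Sc closed_K)
  next
    have lin: "linear_map_on (pull ` space K) S" using S by (simp add: is_antipode_def space_H)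
    fix u c assume u: "u \<in> space K"
    have "S (scl c (pull u)) = scl c (S (pull u))"
      using lin u unfolding linear_map_on_def by blast
    also have "\<dots> = pull (scl c (push (S (pull u))))"
      using u by (simp only: pull_scl[symmetric] Sc)
    finally show "push (S (pull (scl c u))) = scl c (push (S (pull u)))"
      using u by (simp only: pull_scl push_pull Sc closed_K)
  qed
  fix u assume u: "u \<in> space K"
  then show "push (S (pull u)) \<in> space K" by (rule Sc)
  fix qs assume qs: "decomposes K u qs"
  then have q: "set qs \<subseteq> space K \<times> space K" by (simp add: decomposes_def)
  have pu: "pull u \<in> space H" using u by (simp add: space_H)
  have "decomposes H (pull u) (pull_list qs)"
    using qs u by (auto simp: decomposes_def comult_H tensor_sum_pull_list space_H)
  then have S': "(\<Sum>(v, w)\<leftarrow>pull_list qs. mult H (S v) w) = scl (counit H (pull u)) (unit H)"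
    "(\<Sum>(v, w)\<leftarrow>pull_list qs. mult H v (S w)) = scl (counit H (pull u)) (unit H)"
    using S pu unfolding is_antipode_def by blast+
  \<comment> \<open>Membership of the sums in the space of \<open>K\<close> is what allows
    \<open>pull\<close> to be cancelled by \<open>pull_inject\<close>.\<close>
  have sl: "(\<Sum>p\<leftarrow>rs. h p) \<in> space K" if "\<And>p. p \<in> set rs \<Longrightarrow> h p \<in> space K"
    for rs and h :: "('y \<Rightarrow> 'k) \<times> ('y \<Rightarrow> 'k) \<Rightarrow> 'y \<Rightarrow> 'k"
    using that by (induction rs) (auto simp: closed_K fun_space.subspace_0[OF subspace_K])
  have "pull (\<Sum>(v, w)\<leftarrow>qs. mult K (push (S (pull v))) w) = (\<Sum>(v, w)\<leftarrow>pull_list qs. mult H (S v) w)"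
    unfolding pull_sum_list[symmetric] using q
    by (simp add: o_def[of _ "map_prod _ _"], intro arg_cong[where f = sum_list] map_cong)
      (auto simp: mult_H[symmetric] Sc)
  also have "\<dots> = pull (scl (counit K u) (unit K))"
    unfolding S' using u by (simp add: counit_H unit_H pull_scl)
  finally show "(\<Sum>(v, w)\<leftarrow>qs. mult K (push (S (pull v))) w) = scl (counit K u) (unit K)"
    using q by (subst (asm) pull_inject) (auto intro!: sl closed_K Sc)
  have "pull (\<Sum>(v, w)\<leftarrow>qs. mult K v (push (S (pull w)))) = (\<Sum>(v, w)\<leftarrow>pull_list qs. mult H v (S w))"
    unfolding pull_sum_list[symmetric] using q
    by (simp add: o_def[of _ "map_prod _ _"], intro arg_cong[where f = sum_list] map_cong)
      (auto simp: mult_H[symmetric] Sc)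
  also have "\<dots> = pull (scl (counit K u) (unit K))"
    unfolding S' using u by (simp add: counit_H unit_H pull_scl)
  finally show "(\<Sum>(v, w)\<leftarrow>qs. mult K v (push (S (pull w)))) = scl (counit K u) (unit K)"
    using q by (subst (asm) pull_inject) (auto intro!: sl closed_K Sc)
qed

lemma hopf_iso_push:
  assumes unique: "\<And>S T u. is_antipode K S \<Longrightarrow> is_antipode K T \<Longrightarrow> u \<in> space K \<Longrightarrow> S u = T u"
  shows "hopf_iso H K push"
  unfolding hopf_iso_def
proof (intro conjI ballI allI impI)
  obtain S where "is_antipode K S" using hopf_K by (auto simp: is_hopf_algebra_def)
  then show "is_hopf_algebra H"
    using is_bialgebra_H antipode_pull unfolding is_hopf_algebra_def by blast
  show "is_hopf_algebra K" by (rule hopf_K)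
  show "algebra_iso H K push"
    unfolding algebra_iso_def
  proof (intro conjI ballI)
    show "bij_betw push (space H) (space K)"
      by (rule bij_betw_byWitness[where f' = pull]) (auto simp: space_H)
    show "linear_map_on (space H) push"
      by (auto simp: linear_map_on_def space_H pull_add pull_scl closed_K)
    show "push (unit H) = unit K" by (simp add: unit_H closed_K)
    show "push (mult H f g) = mult K (push f) (push g)" if "f \<in> space H" "g \<in> space H" for f g
      using that by (auto simp: space_H mult_H closed_K)
  qed
  fix f assume "f \<in> space H"
  then obtain u where u: "f = pull u" "u \<in> space K" by (auto simp: space_H)
  then show "counit K (push f) = counit H f" by (simp add: counit_H)
  show "comult K (push f) = (\<Sum>(v, w)\<leftarrow>ps. push v \<otimes> push w)" if ps: "decomposes H f ps" for ps
  proof -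
    obtain qs where qs: "ps = pull_list qs" "decomposes K u qs" "set qs \<subseteq> space K \<times> space K"
      using decomposes_pull_list u ps by blast
    have "map (\<lambda>(v, w). push v \<otimes> push w) ps = map (\<lambda>(v, w). v \<otimes> w) qs"
      unfolding qs(1) using qs(3) by auto
    then show ?thesis using qs(2) u by (simp add: decomposes_def tensor_sum_def)
  qed
  show "push (S f) = T (push f)" if "is_antipode H S" "is_antipode K T" for S T
    using unique[OF antipode_push[OF that(1)] that(2) u(2)] u by simp
qed

end

section \<open>QSym as a pullback\<close>

lemma M_sentence:
  "I \<in> sentences A \<Longrightarrow> (M I :: ('a, 'i::linorder, 'k::field) pc_series) = basis I \<circ> word_seq"
  by (simp add: M_eq_basis_word_seq sentences_iff)

text \<open>The coefficient function on sentences is the same for every index order, so one function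
  describes both a series and its doubling.\<close>

lemma sum_M_eq:
  assumes "S \<subseteq> sentences A"
  shows "(\<Sum>I\<in>S. scl (c I) (M I :: ('a, 'i::linorder, 'k::field) pc_series)) =
    (\<Sum>I\<in>S. scl (c I) (basis I)) \<circ> word_seq"
proof
  fix m :: "('a, 'i) pcmon"
  have "(\<Sum>I\<in>S. scl (c I) (M I :: ('a, 'i, 'k) pc_series)) = (\<Sum>I\<in>S. scl (c I) (basis I \<circ> word_seq))"
    using assms by (intro sum.cong refl) (auto simp: M_sentence)
  then show "(\<Sum>I\<in>S. scl (c I) (M I :: ('a, 'i, 'k) pc_series)) m =
      ((\<Sum>I\<in>S. scl (c I) (basis I)) \<circ> word_seq) m"
    by (simp only: sum_fun_apply o_apply scl_def)
qed

text \<open>A span contains only finite combinations of the \<open>M I\<close>; by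
  \<open>NSym_dual_expansion\<close> the graded dual has no others either.\<close>

lemma QSym_space_eq:
  assumes "finite A"
  shows "(QSym_space A :: ('a, nat, 'k::field) pc_series set) = (\<lambda>u. u \<circ> word_seq) ` space (NSym_dual A)"
    (is "_ = ?R")
proof
  have sub: "fun_space.subspace (space (NSym_dual A) :: ('a list list \<Rightarrow> 'k) set)"
    by (rule subspace_NSym_dual)
  have "fun_space.subspace ?R"
  proof (rule fun_space.subspaceI)
    show "0 \<in> ?R" by (rule image_eqI[OF _ fun_space.subspace_0[OF sub]]) auto
    fix f g assume "f \<in> ?R" "g \<in> ?R"
    then obtain u v where "f = u \<circ> word_seq" "u \<in> space (NSym_dual A)" "g = v \<circ> word_seq" "v \<in> space (NSym_dual A)"
      by auto
    then show "f + g \<in> ?R"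
      by (intro image_eqI[of _ _ "u + v"] fun_space.subspace_add[OF sub]) auto
  next
    fix f c assume "f \<in> ?R"
    then obtain u where "f = u \<circ> word_seq" "u \<in> space (NSym_dual A)" by auto
    then show "scl c f \<in> ?R"
      by (intro image_eqI[of _ _ "scl c u"] fun_space.subspace_scale[OF sub]) (auto simp: scl_def)
  qed
  moreover have "M ` sentences A \<subseteq> ?R"
    by (auto simp: M_sentence[of _ A])
  ultimately show "QSym_space A \<subseteq> ?R" unfolding QSym_space_def by (intro fun_space.span_minimal)
  show "?R \<subseteq> QSym_space A"
  proof
    fix f assume "f \<in> ?R"
    then obtain u where u: "f = u \<circ> word_seq" "u \<in> space (NSym_dual A)" by auto
    note e = NSym_dual_expansion[OF assms u(2)]
    have "f = (\<Sum>I | u I \<noteq> 0. scl (u I) (M I))"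
      unfolding sum_M_eq[OF e(2)] u(1) by (rule arg_cong[OF e(3)])
    also have "\<dots> \<in> QSym_space A"
      unfolding QSym_space_def using e(2)
      by (intro fun_space.span_sum fun_space.span_scale fun_space.span_base) auto
    finally show "f \<in> QSym_space A" .
  qed
qed

text \<open>Coefficients with respect to the \<open>M I\<close> over \<open>nat\<close> are unique
  because pulling back is injective. So the description in \<open>doubled\<close> has exactly one
  solution: the same function of the sentence, read over the doubled indices.\<close>

lemma doubled_word_seq:
  fixes u :: "'a list list \<Rightarrow> 'k::field"
  assumes "finite A" "u \<in> space (NSym_dual A)"
  shows "doubled A (u \<circ> word_seq) = u \<circ> word_seq"
  unfolding doubled_def
proof (rule the_equality)
  note e = NSym_dual_expansion[OF assms]
  show "\<exists>S c. finite S \<and> S \<subseteq> sentences A \<and>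
      u \<circ> word_seq = (\<Sum>I\<in>S. scl (c I) (M I :: ('a, nat, 'k) pc_series)) \<and>
      u \<circ> word_seq = (\<Sum>I\<in>S. scl (c I) (M I :: ('a, dindex, 'k) pc_series))"
    using e(1,2) by (intro exI[of _ "{I. u I \<noteq> 0}"] exI[of _ u]) (simp add: sum_M_eq flip: e(3))
  fix F :: "('a, dindex, 'k) pc_series"
  assume "\<exists>S c. finite S \<and> S \<subseteq> sentences A \<and>
      u \<circ> word_seq = (\<Sum>I\<in>S. scl (c I) (M I :: ('a, nat, 'k) pc_series)) \<and> F = (\<Sum>I\<in>S. scl (c I) (M I))"
  then obtain S c where S: "S \<subseteq> sentences A"
    "u \<circ> word_seq = (\<Sum>I\<in>S. scl (c I) (M I :: ('a, nat, 'k) pc_series))" "F = (\<Sum>I\<in>S. scl (c I) (M I))"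
    by blast
  have "u = (\<Sum>I\<in>S. scl (c I) (basis I))"
    using assms(2) sum_basis_in_NSym_dual[OF S(1)] S(2) unfolding sum_M_eq[OF S(1)] by (rule eq_if_pullback_eq)
  then show "F = u \<circ> word_seq" using S(3) unfolding sum_M_eq[OF S(1)] by simp
qed

text \<open>Existence: a doubled monomial has the sentence \<open>word_seq p @ word_seq q\<close>,
  so a decomposition of the coproduct of \<open>u\<close> also decomposes the doubled series.
  Uniqueness: the value of any candidate at \<open>(p, q)\<close> is the coefficient of
  \<open>p(x) q(y)\<close> in the doubled series.\<close>

lemma doubling_coproduct_word_seq:
  fixes u :: "'a list list \<Rightarrow> 'k::field"
  assumes "finite A" "u \<in> space (NSym_dual A)"
  shows "doubling_coproduct A (u \<circ> word_seq) = comult (NSym_dual A) u \<circ> map_prod word_seq word_seq"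
  unfolding doubling_coproduct_def
proof (rule the_equality)
  let ?X = "space (NSym_dual A) :: ('a list list \<Rightarrow> 'k) set"
  obtain qs where qs: "set qs \<subseteq> ?X \<times> ?X" "comult (NSym_dual A) u = tensor_sum qs"
    using comult_NSym_dual_in_tensor_space[OF assms] by (auto simp: tensor_space_def)
  let ?ps = "map (\<lambda>(v, w). (v \<circ> word_seq, w \<circ> word_seq)) qs ::
      (('a, nat, 'k) pc_series \<times> ('a, nat, 'k) pc_series) list"
  have u_tensor: "u (I @ J) = (\<Sum>(v, w)\<leftarrow>qs. v I * w J)" for I J
    using qs(2) comult_NSym_dual[OF assms(2), of I J] by (simp add: tensor_sum_apply)
  have "set ?ps \<subseteq> QSym_space A \<times> QSym_space A"
    using qs(1) by (auto simp: QSym_space_eq[OF assms(1)])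
  moreover have "doubled A (u \<circ> word_seq) = (\<Sum>(f', f'')\<leftarrow>?ps. pc_mult (series_x f') (series_y f''))"
  proof
    fix m :: "('a, dindex) pcmon"
    obtain p q where m: "m = mon_x p * mon_y q" using ex_mon_x_y by blast
    show "doubled A (u \<circ> word_seq) m = (\<Sum>(f', f'')\<leftarrow>?ps. pc_mult (series_x f') (series_y f'')) m"
      unfolding m doubled_word_seq[OF assms]
      by (simp add: word_seq_mon_x_y u_tensor sum_list_fun_apply case_prod_unfold pc_mult_series_x_y o_def)
  qed
  moreover have "comult (NSym_dual A) u \<circ> map_prod word_seq word_seq = tensor_sum ?ps"
    by (auto simp: fun_eq_iff qs(2) tensor_sum_apply case_prod_unfold o_def)
  ultimately show "\<exists>ps. set ps \<subseteq> QSym_space A \<times> QSym_space A \<and>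
      doubled A (u \<circ> word_seq) = (\<Sum>(f', f'')\<leftarrow>ps. pc_mult (series_x f') (series_y f'')) \<and>
      comult (NSym_dual A) u \<circ> map_prod word_seq word_seq = tensor_sum ps" by blast
next
  fix T :: "('a, nat) pcmon \<times> ('a, nat) pcmon \<Rightarrow> 'k"
  assume "\<exists>ps. set ps \<subseteq> QSym_space A \<times> QSym_space A \<and>
      doubled A (u \<circ> word_seq) = (\<Sum>(f', f'')\<leftarrow>ps. pc_mult (series_x f') (series_y f'')) \<and>
      T = tensor_sum ps"
  then obtain ps where
    ps: "doubled A (u \<circ> word_seq) = (\<Sum>(f', f'')\<leftarrow>ps. pc_mult (series_x f') (series_y f''))"
    and T: "T = tensor_sum ps" by blast
  show "T = comult (NSym_dual A) u \<circ> map_prod word_seq word_seq"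
  proof (rule ext, clarify)
    fix p q
    have "T (p, q) = (\<Sum>(f', f'')\<leftarrow>ps. pc_mult (series_x f') (series_y f'')) (mon_x p * mon_y q)"
      by (simp add: T tensor_sum_apply sum_list_fun_apply case_prod_unfold pc_mult_series_x_y)
    also have "\<dots> = u (word_seq p @ word_seq q)"
      by (simp add: doubled_word_seq[OF assms] word_seq_mon_x_y flip: ps)
    finally show "T (p, q) = (comult (NSym_dual A) u \<circ> map_prod word_seq word_seq) (p, q)"
      using comult_NSym_dual[OF assms(2)] by simp
  qed
qed

lemma word_seq_one [simp]: "word_seq 1 = []"
  by (simp add: word_seq_def pc_support_def)

lemma hopf_pullback_QSym:
  assumes "finite A"
  shows "hopf_pullback (QSym A :: (('a, nat) pcmon, 'k::field) hopf_data) (NSym_dual A) word_seq"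
proof
  show "space (QSym A :: (('a, nat) pcmon, 'k) hopf_data) = (\<lambda>u. u \<circ> word_seq) ` space (NSym_dual A)"
    by (simp add: QSym_def QSym_space_eq[OF assms])
  show "unit (QSym A) = unit (NSym_dual A) \<circ> (word_seq :: ('a, nat) pcmon \<Rightarrow> _)"
    by (simp add: QSym_def unit_NSym_dual M_eq_basis_word_seq)
  show "is_hopf_algebra (NSym_dual A)" using assms by (rule is_hopf_algebra_NSym_dual)
  fix u :: "'a list list \<Rightarrow> 'k" assume u: "u \<in> space (NSym_dual A)"
  show "u I = 0" if "I \<notin> range (word_seq :: ('a, nat) pcmon \<Rightarrow> _)" for I
    using u that by (auto simp: space_NSym_dual range_word_seq sentences_iff)
  show "comult (QSym A) (u \<circ> word_seq) = comult (NSym_dual A) u \<circ> map_prod word_seq word_seq"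
    by (simp add: QSym_def doubling_coproduct_word_seq[OF assms u])
  show "counit (QSym A) (u \<circ> word_seq) = counit (NSym_dual A) u"
    by (simp add: QSym_def counit_NSym_dual)
  show "mult (QSym A) (u \<circ> word_seq) (v \<circ> word_seq) = mult (NSym_dual A) u v \<circ> word_seq"
    if "v \<in> space (NSym_dual A)" for v
    using u that by (simp add: QSym_def pc_mult_word_seq)
qed

theorem proposition4p3:
  fixes A :: "'a set"
  assumes "finite A"
  shows "(\<exists>\<phi>. (\<forall>I\<in>sentences A. \<phi> (M I) = H_dual I) \<and>
              hopf_iso (QSym A :: (('a, nat) pcmon, 'k::field_char_0) hopf_data) (NSym_dual A) \<phi>)
       \<and> (\<forall>I\<in>sentences A.
            comult (QSym A :: (('a, nat) pcmon, 'k) hopf_data) (M I) =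
              (\<Sum>(J, K) | J @ K = I. M J \<otimes> M K))
       \<and> (\<forall>ws\<in>sentences A.
            comult (QSym A :: (('a, nat) pcmon, 'k) hopf_data) (M ws) =
              (\<Sum>j = 0..length ws. M (take j ws) \<otimes> M (drop j ws)))"
proof -
  interpret hopf_pullback "QSym A :: (('a, nat) pcmon, 'k) hopf_data" "NSym_dual A" word_seq
    using assms by (rule hopf_pullback_QSym)
  have "push (M I) = H_dual I" if "I \<in> sentences A" for I
    using that by (simp add: M_sentence[of I A])
  moreover have "hopf_iso (QSym A :: (('a, nat) pcmon, 'k) hopf_data) (NSym_dual A) push"
    by (rule hopf_iso_push) (rule antipode_NSym_dual_unique[OF assms])
  moreover have deconcat: "comult (QSym A :: (('a, nat) pcmon, 'k) hopf_data) (M I) =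
      (\<Sum>j = 0..length I. M (take j I) \<otimes> M (drop j I))" if I: "I \<in> sentences A" for I
  proof -
    have "comult (QSym A :: (('a, nat) pcmon, 'k) hopf_data) (M I) =
        comult (NSym_dual A) (basis I) \<circ> map_prod word_seq word_seq"
      by (simp add: M_sentence[OF I] comult_H I)
    also have "\<dots> = (\<Sum>j = 0..length I. pull (basis (take j I)) \<otimes> pull (basis (drop j I)))"
      by (simp only: comult_basis_NSym_dual[OF I] pull_tensor fun_eq_iff o_apply sum_fun_apply simp_thms)
    also have "\<dots> = (\<Sum>j = 0..length I. M (take j I) \<otimes> M (drop j I))"
      using take_drop_sentences[OF I] by (simp add: M_sentence[of _ A])
    finally show ?thesis .
  qed
  moreover have "comult (QSym A :: (('a, nat) pcmon, 'k) hopf_data) (M I) =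
      (\<Sum>(J, K) | J @ K = I. M J \<otimes> M K)" if "I \<in> sentences A" for I
    unfolding deconcat[OF that] by (rule sum_append_eq[symmetric])
  ultimately show ?thesis by blast
qed

end
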